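(* Let $\mathrm U(2)^{\pm1}$, $\rho$ and $\widetilde\rho$ be as in the context. There is a commutative diagram of groups with exact rows $$1\to\mathrm{SU}(2)\xrightarrow{\ i\ }\mathrm U(2)^{\pm1}\xrightarrow{\det}\{\pm1\}\to1,\qquad 1\to\mathrm{SO}(3)\xrightarrow{\ j\ }\mathrm O(3)\xrightarrow{\det}\{\pm1\}\to1$$ and exact columns $$1\to\{\pm\mathbf 1\}\to\mathrm{SU}(2)\xrightarrow{\ \rho\ }\mathrm{SO}(3)\to1,\qquad 1\to\{\pm\mathbf 1\}\to\mathrm U(2)^{\pm1}\xrightarrow{\ \widetilde\rho\ }\mathrm O(3)\to1,$$ where $i,j$ are the inclusions; commutativity means that $\widetilde\rho\circ i=j\circ\rho$, that $\det\circ\widetilde\rho=\det$ on $\mathrm U(2)^{\pm1}$, and that $i$ restricts to the identity on the kernels $\{\pm\mathbf 1\}$. Here $\rho\colon\mathrm{SU}(2)\to\mathrm{SO}(3)$ is the universal covering of $\mathrm{SO}(3)$, and $\widetilde\rho$ identifies with the canonical covering of $\mathrm O(3)$ by the Pin group $\mathsf{PIN}^+(3)$ described in the context. Further, $x\in\mathrm U(2)^{\pm1}$ is a (complex) reflection of order $2$ in $\mathrm{GL}(2,\mathbb C)$ if, and only if, $\widetilde\rho(x)$ is a (real) reflection in $\mathrm O(3)$.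
   Context: $\mathbf 1$ denotes the identity matrix. Unimodular unitary group: $\mathrm U(2)^{\pm1}=\{A\in\mathrm{GL}(2,\mathbb C)\mid A\overline A^{T}=\mathbf 1,\ \det A=\pm1\}$. Reflection: a linear endomorphism $s$ of a finite dimensional vector space $V$ over a field $K$ of characteristic not $2$ is a reflection (of order 2) if there are a linear form $\lambda\colon V\to K$ and $a\in V$ with $\lambda(a)=1$ and $s(v)=v-2\lambda(v)a$ for all $v$. The maps $\rho,\widetilde\rho$: let $\mathfrak{su}(2)=\{B\in\mathrm{Mat}_{2\times2}(\mathbb C)\mid \overline B^{T}=-B,\ \operatorname{tr}B=0\}$, a $3$-dimensional real vector space on which $\det$ is the standard Euclidean square norm; $\mathrm O(3)$ is identified with the group of $\mathbb R$-linear automorphisms of $\mathfrak{su}(2)$ preserving $\det$, and $\mathrm{SO}(3)$ with its determinant-one subgroup. For $A\in\mathrm U(2)^{\pm1}$, $B\in\mathfrak{su}(2)$ set $\widetilde\rho(A)(B)=(\det A)\,ABA^{-1}$, and $\rho=\widetilde\rho|_{\mathrm{SU}(2)}$. Pin group and its covering: the Clifford algebra of Euclidean $3$-space is realized as the real algebra $\mathit{Cl}=\mathrm{Mat}_{2\times2}(\mathbb C)$ with Euclidean $3$-space $E=\mathbb R e_1\oplus\mathbb R e_2\oplus\mathbb R e_3$ spanned by the Pauli matrices $e_1=\begin{pmatrix}0&1\\1&0\end{pmatrix}$, $e_2=\begin{pmatrix}0&-i\\i&0\end{pmatrix}$, $e_3=\begin{pmatrix}1&0\\0&-1\end{pmatrix}$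 and quadratic form $v\mapsto v^2$; one has $E=\mathfrak{su}(2)\cdot i$. Let $\mathit{Cl}^{\underline0}$ be the real span of $\mathbf 1,e_1e_2,e_1e_3,e_2e_3$ and $\mathit{Cl}^{\underline1}$ that of $e_1,e_2,e_3,e_1e_2e_3$, and let $\mathit{Cl}^*_{hom}$ be the group of invertible elements in $\mathit{Cl}^{\underline0}\cup\mathit{Cl}^{\underline1}$. Let $\alpha$ be the algebra automorphism equal to $+1$ on $\mathit{Cl}^{\underline0}$ and $-1$ on $\mathit{Cl}^{\underline1}$, let $x\mapsto\overline x$ be the algebra anti-automorphism with $\overline v=-v$ for $v\in E$, and $N(x)=\overline xx$, which is real-valued and multiplicative on $\mathit{Cl}^*_{hom}$. Then $\mathsf{PIN}^+(3)=\ker(N^2\colon\mathit{Cl}^*_{hom}\to\mathbb R^* )$, and the canonical covering is $u\mapsto\big(v\mapsto\alpha(u)vu^{-1}\big)$, $v\in E$; $E$ is identified with $\mathfrak{su}(2)$ through multiplication by $i$. *)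

theory Defs
  imports "HOL-Analysis.Analysis" "HOL-Algebra.Coset" "HOL-Algebra.Bij"
begin

section \<open>Matrices\<close>

type_synonym cmat2 = "complex^2^2"

definition mat2 :: "'a \<Rightarrow> 'a \<Rightarrow> 'a \<Rightarrow> 'a \<Rightarrow> 'a::zero^2^2" where
  "mat2 a b c d = vector [vector [a, b], vector [c, d]]"

definition cscale :: "complex \<Rightarrow> cmat2 \<Rightarrow> cmat2"  (infixr \<open>*\<^sub>C\<close> 75) where
  "c *\<^sub>C A = map_matrix ((*) c) A"

definition ctranspose :: "cmat2 \<Rightarrow> cmat2" where
  "ctranspose A = transpose (map_matrix cnj A)"

definition U2pm :: "cmat2 monoid" where
  "U2pm = \<lparr>carrier = {A. invertible A \<and> A ** ctranspose A = mat 1 \<and> det A \<in> {1, - 1}},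
           mult = (**), one = mat 1\<rparr>"

definition SU2 :: "cmat2 monoid" where
  "SU2 = U2pm\<lparr>carrier := {A \<in> carrier U2pm. det A = 1}\<rparr>"

definition pm_id_group :: "cmat2 monoid" where
  "pm_id_group = U2pm\<lparr>carrier := {mat 1, - mat 1}\<rparr>"

text \<open>The signs are taken in \<open>\<complex>\<close>, where \<^const>\<open>det\<close> on complex matrices takes its values; real
  determinants are mapped into it by \<^const>\<open>complex_of_real\<close>.\<close>

definition sign_group :: "complex monoid" where
  "sign_group = \<lparr>carrier = {1, - 1}, mult = (*), one = 1\<rparr>"

section \<open>Exact sequences and coverings\<close>

text \<open>Exactness of \<open>1 \<rightarrow> K \<rightarrow> G \<rightarrow> H \<rightarrow> 1\<close> at \<open>K\<close>, \<open>G\<close> and \<open>H\<close>. The predicate \<open>exact_seq\<close> of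
  \<open>HOL-Algebra\<close> only covers groups whose elements all have the same type.\<close>

definition short_exact ::
    "'a monoid \<Rightarrow> 'b monoid \<Rightarrow> 'c monoid \<Rightarrow> ('a \<Rightarrow> 'b) \<Rightarrow> ('b \<Rightarrow> 'c) \<Rightarrow> bool" where
  "short_exact K G H f g \<longleftrightarrow>
     group_hom K G f \<and> group_hom G H g \<and>
     kernel K G f = {\<one>\<^bsub>K\<^esub>} \<and> f ` carrier K = kernel G H g \<and> g ` carrier G = carrier H"

definition group_covering ::
    "'a::topological_space monoid \<Rightarrow> ('a \<Rightarrow> 'b) \<Rightarrow> 'b::topological_space monoid \<Rightarrow> bool" where
  "group_covering G p H \<longleftrightarrow> group_hom G H p \<and> covering_space (carrier G) p (carrier H)"

text \<open>Simply connected sets are path connected in \<open>HOL-Analysis\<close>.\<close>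

definition universal_group_covering ::
    "'a::topological_space monoid \<Rightarrow> ('a \<Rightarrow> 'b) \<Rightarrow> 'b::topological_space monoid \<Rightarrow> bool" where
  "universal_group_covering G p H \<longleftrightarrow> group_covering G p H \<and> simply_connected (carrier G)"

definition top_group_iso ::
    "'a::topological_space monoid \<Rightarrow> 'b::topological_space monoid \<Rightarrow> ('a \<Rightarrow> 'b) \<Rightarrow> bool" where
  "top_group_iso G H \<phi> \<longleftrightarrow> \<phi> \<in> iso G H \<and> (\<exists>\<psi>. homeomorphism (carrier G) (carrier H) \<phi> \<psi>)"

text \<open>The pair \<open>(\<phi>, \<psi>)\<close> identifies the covering \<open>p : G \<rightarrow> H\<close> with \<open>p' : G' \<rightarrow> H'\<close>.\<close>

definition identifies_coverings where
  "identifies_coverings \<phi> \<psi> G p H G' p' H' \<longleftrightarrow>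
     group_covering G p H \<and> group_covering G' p' H' \<and>
     top_group_iso G G' \<phi> \<and> top_group_iso H H' \<psi> \<and>
     (\<forall>u\<in>carrier G. p' (\<phi> u) = \<psi> (p u))"

section \<open>Automorphism groups of a quadratic form, and reflections\<close>

definition linear_on_set ::
    "('k::field \<Rightarrow> 'v::ab_group_add \<Rightarrow> 'v) \<Rightarrow> ('k \<Rightarrow> 'w::ab_group_add \<Rightarrow> 'w) \<Rightarrow> 'v set \<Rightarrow> ('v \<Rightarrow> 'w) \<Rightarrow> bool"
  where
  "linear_on_set sV sW V f \<longleftrightarrow>
     (\<forall>x\<in>V. \<forall>y\<in>V. f (x + y) = f x + f y) \<and> (\<forall>c. \<forall>x\<in>V. f (sV c x) = sW c (f x))"

text \<open>Elements are functions that are \<^const>\<open>undefined\<close> outside the subspace \<open>V\<close>. As a subset of the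
  type of all functions the group carries the topology of pointwise convergence on \<open>V\<close>, which for
  finite dimensional \<open>V\<close> is its usual topology as a group of matrices.\<close>

definition orthogonal_group :: "'v::real_vector set \<Rightarrow> ('v \<Rightarrow> 'q) \<Rightarrow> ('v \<Rightarrow> 'v) monoid" where
  "orthogonal_group V q =
     (BijGroup V)\<lparr>carrier :=
        {f \<in> Bij V. linear_on_set scaleR scaleR V f \<and> (\<forall>v\<in>V. q (f v) = q v)}\<rparr>"

definition is_reflection ::
    "('k::field \<Rightarrow> 'v::ab_group_add \<Rightarrow> 'v) \<Rightarrow> 'v set \<Rightarrow> ('v \<Rightarrow> 'v) \<Rightarrow> bool" where
  "is_reflection sV V s \<longleftrightarrow>
     (\<exists>l a. linear_on_set sV (*) V l \<and> a \<in> V \<and> l a = 1 \<and> (\<forall>v\<in>V. s v = v - sV (2 * l v) a))"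

section \<open>The orthogonal group of \<open>su(2)\<close> and the maps \<open>\<rho>\<close>\<close>

definition su2 :: "cmat2 set" where
  "su2 = {B. ctranspose B = - B \<and> trace B = 0}"

definition O3 :: "(cmat2 \<Rightarrow> cmat2) monoid" where
  "O3 = orthogonal_group su2 det"

definition e1 :: cmat2 where "e1 = mat2 0 1 1 0"
definition e2 :: cmat2 where "e2 = mat2 0 (- \<i>) \<i> 0"
definition e3 :: cmat2 where "e3 = mat2 1 0 0 (- 1)"

definition su2_frame :: "real^3 \<Rightarrow> cmat2" where
  "su2_frame x = x$1 *\<^sub>R \<i> *\<^sub>C e1 + x$2 *\<^sub>R \<i> *\<^sub>C e2 + x$3 *\<^sub>R \<i> *\<^sub>C e3"

text \<open>Determinant of an endomorphism of \<open>su(2)\<close>, computed in the basis \<open>i e\<^sub>1, i e\<^sub>2, i e\<^sub>3\<close>.\<close>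

definition su2_det :: "(cmat2 \<Rightarrow> cmat2) \<Rightarrow> real" where
  "su2_det f = det (matrix (inv_into UNIV su2_frame \<circ> f \<circ> su2_frame))"

definition SO3 :: "(cmat2 \<Rightarrow> cmat2) monoid" where
  "SO3 = O3\<lparr>carrier := {f \<in> carrier O3. su2_det f = 1}\<rparr>"

definition rho_tilde :: "cmat2 \<Rightarrow> cmat2 \<Rightarrow> cmat2" where
  "rho_tilde A = (\<lambda>B\<in>su2. det A *\<^sub>C (A ** B ** matrix_inv A))"

definition rho :: "cmat2 \<Rightarrow> cmat2 \<Rightarrow> cmat2" where
  "rho = restrict rho_tilde (carrier SU2)"

section \<open>The Pin group\<close>

definition E3 :: "cmat2 set" where "E3 = span {e1, e2, e3}"

definition Cl0 :: "cmat2 set" where "Cl0 = span {mat 1, e1 ** e2, e1 ** e3, e2 ** e3}"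

definition Cl1 :: "cmat2 set" where "Cl1 = span {e1, e2, e3, e1 ** e2 ** e3}"

definition Cl_hom :: "cmat2 monoid" where
  "Cl_hom = \<lparr>carrier = {x \<in> Cl0 \<union> Cl1. invertible x}, mult = (**), one = mat 1\<rparr>"

definition is_alpha :: "(cmat2 \<Rightarrow> cmat2) \<Rightarrow> bool" where
  "is_alpha f \<longleftrightarrow>
     linear f \<and> bij f \<and> (\<forall>x y. f (x ** y) = f x ** f y) \<and> f (mat 1) = mat 1 \<and>
     (\<forall>x\<in>Cl0. f x = x) \<and> (\<forall>x\<in>Cl1. f x = - x)"

definition is_bar :: "(cmat2 \<Rightarrow> cmat2) \<Rightarrow> bool" where
  "is_bar f \<longleftrightarrow>
     linear f \<and> bij f \<and> (\<forall>x y. f (x ** y) = f y ** f x) \<and> f (mat 1) = mat 1 \<and>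
     (\<forall>v\<in>E3. f v = - v)"

text \<open>Existence and uniqueness are proved in \<open>ex1_alpha\<close>, \<open>ex1_bar\<close> and \<open>ex1_Cl_norm\<close> below.\<close>

definition Cl_alpha :: "cmat2 \<Rightarrow> cmat2" where "Cl_alpha = (THE f. is_alpha f)"

definition Cl_bar :: "cmat2 \<Rightarrow> cmat2" where "Cl_bar = (THE f. is_bar f)"

definition Cl_norm :: "cmat2 \<Rightarrow> real" where
  "Cl_norm x = (THE r. Cl_bar x ** x = r *\<^sub>R mat 1)"

definition Rstar :: "real monoid" where
  "Rstar = \<lparr>carrier = - {0}, mult = (*), one = 1\<rparr>"

definition PIN3 :: "cmat2 monoid" where
  "PIN3 = Cl_hom\<lparr>carrier := kernel Cl_hom Rstar (\<lambda>x. (Cl_norm x)\<^sup>2)\<rparr>"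

definition O_E3 :: "(cmat2 \<Rightarrow> cmat2) monoid" where
  "O_E3 = orthogonal_group E3 (\<lambda>v. v ** v)"

definition pin_covering :: "cmat2 \<Rightarrow> cmat2 \<Rightarrow> cmat2" where
  "pin_covering u = (\<lambda>v\<in>E3. Cl_alpha u ** v ** matrix_inv u)"

text \<open>The transport of endomorphisms along the isomorphism \<open>v \<mapsto> i v\<close> from \<open>E\<close> to \<open>su(2)\<close>, whose inverse
  is \<open>B \<mapsto> - i B\<close>.\<close>

definition E3_to_su2 :: "(cmat2 \<Rightarrow> cmat2) \<Rightarrow> cmat2 \<Rightarrow> cmat2" where
  "E3_to_su2 f = (\<lambda>B\<in>su2. \<i> *\<^sub>C f ((- \<i>) *\<^sub>C B))"

section \<open>Well-definedness\<close>

lemma cmat2_eq_iff: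
  fixes A B :: "'a^2^2"
  shows "A = B \<longleftrightarrow> A$1$1 = B$1$1 \<and> A$1$2 = B$1$2 \<and> A$2$1 = B$2$1 \<and> A$2$2 = B$2$2"
  by (auto simp: vec_eq_iff forall_2)

lemma mat2_nth [simp]:
  "mat2 a b c d $ 1 $ 1 = a" "mat2 a b c d $ 1 $ 2 = b"
  "mat2 a b c d $ 2 $ 1 = c" "mat2 a b c d $ 2 $ 2 = d"
  by (simp_all add: mat2_def)

lemma cscale_nth [simp]: "(c *\<^sub>C A) $ i $ j = c * A $ i $ j"
  by (simp add: cscale_def map_matrix_def)

lemma mat_nth: "(mat k :: 'a::zero^2^2) $ i $ j = (if i = j then k else 0)"
  by (simp add: mat_def)

lemma mult2_nth: "((A :: 'a::semiring_1^2^2) ** B) $ i $ j = A$i$1 * B$1$j + A$i$2 * B$2$j"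
  by (simp add: matrix_matrix_mult_def sum_2)

lemmas mat2_simps = cmat2_eq_iff mult2_nth mat_nth

lemma pauli_nth [simp]:
  "e1$1$1 = 0" "e1$1$2 = 1" "e1$2$1 = 1" "e1$2$2 = 0"
  "e2$1$1 = 0" "e2$1$2 = - \<i>" "e2$2$1 = \<i>" "e2$2$2 = 0"
  "e3$1$1 = 1" "e3$1$2 = 0" "e3$2$1 = 0" "e3$2$2 = - 1"
  by (simp_all add: e1_def e2_def e3_def)

lemma su2_frame_bij: "bij_betw su2_frame UNIV su2"
proof (rule bij_betwI[where g = "\<lambda>B. vector [Im (B$1$2), Re (B$1$2), Im (B$1$1)]"])
  show "su2_frame \<in> UNIV \<rightarrow> su2"
    by (auto simp: su2_frame_def su2_def ctranspose_def map_matrix_def transpose_def trace_def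
        mat2_simps sum_2 complex_eq_iff)
  show "(\<lambda>B. vector [Im (B$1$2), Re (B$1$2), Im (B$1$1)]) \<in> su2 \<rightarrow> UNIV"
    by simp
  show "vector [Im (su2_frame x$1$2), Re (su2_frame x$1$2), Im (su2_frame x$1$1)] = x" for x
    by (simp add: su2_frame_def vec_eq_iff forall_3)
  show "su2_frame (vector [Im (B$1$2), Re (B$1$2), Im (B$1$1)]) = B" if "B \<in> su2" for B
  proof -
    have "ctranspose B $ i $ j = (- B) $ i $ j" for i j
      using that by (simp add: su2_def)
    from this[of 1 1] this[of 1 2] this[of 2 1] this[of 2 2]
    have "Re (B$1$1) = 0" "Re (B$2$1) = - Re (B$1$2)" "Im (B$2$1) = Im (B$1$2)" "Re (B$2$2) = 0"
      by (simp_all add: ctranspose_def map_matrix_def transpose_def complex_eq_iff)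
    moreover have "Im (B$2$2) = - Im (B$1$1)"
      using that by (simp add: su2_def trace_def sum_2 complex_eq_iff)
    ultimately show ?thesis
      by (simp add: su2_frame_def mat2_simps complex_eq_iff)
  qed
qed

lemma linear_su2_frame: "linear su2_frame"
  by (rule linearI) (simp_all add: su2_frame_def mat2_simps algebra_simps complex_eq_iff)

lemma det_su2_frame: "det (su2_frame x) = complex_of_real ((norm x)\<^sup>2)"
  by (simp add: det_2 su2_frame_def power2_norm_eq_inner inner_vec_def sum_3 complex_eq_iff)

definition alpha_expl :: "cmat2 \<Rightarrow> cmat2" where
  "alpha_expl x = mat2 (cnj (x$2$2)) (- cnj (x$2$1)) (- cnj (x$1$2)) (cnj (x$1$1))"

definition bar_expl :: "cmat2 \<Rightarrow> cmat2" where
  "bar_expl x = mat2 (x$2$2) (- (x$1$2)) (- (x$2$1)) (x$1$1)"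

lemma linear_alpha_expl: "linear alpha_expl"
  by (rule linearI) (simp_all add: alpha_expl_def mat2_simps complex_eq_iff)

lemma linear_bar_expl: "linear bar_expl"
  by (rule linearI) (simp_all add: bar_expl_def mat2_simps)

lemma Cl0_eq: "Cl0 = {x. alpha_expl x = x}"
proof
  have "subspace {x. alpha_expl x = x}"
    using linear_alpha_expl by (auto simp: subspace_def linear_add linear_scale linear_0)
  then show "Cl0 \<subseteq> {x. alpha_expl x = x}"
    unfolding Cl0_def by (rule span_minimal[rotated]) (simp add: alpha_expl_def mat2_simps)
  show "{x. alpha_expl x = x} \<subseteq> Cl0"
  proof
    fix x assume "x \<in> {x. alpha_expl x = x}"
    then have "alpha_expl x $ 2 $ 2 = (x) $ 2 $ 2" "alpha_expl x $ 2 $ 1 = (x) $ 2 $ 1"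
      by simp_all
    then have "x $ 2 $ 2 = cnj (x $ 1 $ 1)" "x $ 2 $ 1 = - cnj (x $ 1 $ 2)"
      by (auto simp: alpha_expl_def complex_eq_iff)
    then have "x = Re (x$1$1) *\<^sub>R mat 1 + Im (x$1$1) *\<^sub>R (e1 ** e2)
                 + (- Re (x$1$2)) *\<^sub>R (e1 ** e3) + Im (x$1$2) *\<^sub>R (e2 ** e3)"
      by (simp add: mat2_simps complex_eq_iff)
    also have "\<dots> \<in> Cl0"
      unfolding Cl0_def by (intro span_add span_scale span_base) auto
    finally show "x \<in> Cl0" .
  qed
qed

lemma Cl1_eq: "Cl1 = {x. alpha_expl x = - x}"
proof
  have "subspace {x. alpha_expl x = - x}"
    using linear_alpha_expl by (auto simp: subspace_def linear_add linear_scale linear_0)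
  then show "Cl1 \<subseteq> {x. alpha_expl x = - x}"
    unfolding Cl1_def by (rule span_minimal[rotated]) (simp add: alpha_expl_def mat2_simps)
  show "{x. alpha_expl x = - x} \<subseteq> Cl1"
  proof
    fix x assume "x \<in> {x. alpha_expl x = - x}"
    then have "alpha_expl x $ 2 $ 2 = (- x) $ 2 $ 2" "alpha_expl x $ 2 $ 1 = (- x) $ 2 $ 1"
      by simp_all
    then have "x $ 2 $ 2 = - cnj (x $ 1 $ 1)" "x $ 2 $ 1 = cnj (x $ 1 $ 2)"
      by (auto simp: alpha_expl_def complex_eq_iff)
    then have "x = Re (x$1$2) *\<^sub>R e1 + (- Im (x$1$2)) *\<^sub>R e2
                 + Re (x$1$1) *\<^sub>R e3 + Im (x$1$1) *\<^sub>R (e1 ** e2 ** e3)"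
      by (simp add: mat2_simps complex_eq_iff)
    also have "\<dots> \<in> Cl1"
      unfolding Cl1_def by (intro span_add span_scale span_base) auto
    finally show "x \<in> Cl1" .
  qed
qed

lemma Cl_decomp:
  obtains y z where "y \<in> Cl0" "z \<in> Cl1" "x = y + z"
proof
  show "(1/2) *\<^sub>R (x + alpha_expl x) \<in> Cl0" "(1/2) *\<^sub>R (x - alpha_expl x) \<in> Cl1"
    by (simp_all add: Cl0_eq Cl1_eq alpha_expl_def mat2_simps complex_eq_iff field_simps)
  show "x = (1/2) *\<^sub>R (x + alpha_expl x) + (1/2) *\<^sub>R (x - alpha_expl x)"
    by (simp add: mat2_simps complex_eq_iff field_simps)
qed

lemma is_alpha_expl: "is_alpha alpha_expl"
proof -
  have "bij alpha_expl"
    by (rule o_bij[where g = alpha_expl]) (auto simp: fun_eq_iff alpha_expl_def mat2_simps)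
  then show ?thesis
    unfolding is_alpha_def
    by (simp add: linear_alpha_expl Cl0_eq Cl1_eq)
       (simp add: alpha_expl_def mat2_simps)
qed

lemma is_alpha_unique: "is_alpha f \<Longrightarrow> f = alpha_expl"
proof
  fix x assume f: "is_alpha f"
  obtain y z where "y \<in> Cl0" "z \<in> Cl1" "x = y + z" by (rule Cl_decomp)
  with f is_alpha_expl show "f x = alpha_expl x"
    by (auto simp: is_alpha_def linear_add)
qed

lemma ex1_alpha: "\<exists>!f. is_alpha f"
  using is_alpha_expl is_alpha_unique by blast

lemma Cl_alpha_eq: "Cl_alpha = alpha_expl"
  unfolding Cl_alpha_def using is_alpha_expl is_alpha_unique by blast

lemma is_bar_expl: "is_bar bar_expl"
proof -
  have "bij bar_expl"
    by (rule o_bij[where g = bar_expl]) (auto simp: fun_eq_iff bar_expl_def mat2_simps)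
  moreover have "\<forall>v\<in>E3. bar_expl v = - v"
  proof -
    have "subspace {x. bar_expl x = - x}"
      using linear_bar_expl by (auto simp: subspace_def linear_add linear_scale linear_0)
    then have "E3 \<subseteq> {x. bar_expl x = - x}"
      unfolding E3_def by (rule span_minimal[rotated]) (simp add: bar_expl_def mat2_simps)
    then show ?thesis by blast
  qed
  ultimately show ?thesis
    unfolding is_bar_def
    by (simp add: linear_bar_expl) (simp add: bar_expl_def mat2_simps)
qed

lemma is_bar_unique:
  assumes f: "is_bar f" and g: "is_bar g"
  shows "f = g"
proof
  fix x
  have lin: "linear f" "linear g"
    using f g by (auto simp: is_bar_def)
  have e: "e1 \<in> E3" "e2 \<in> E3" "e3 \<in> E3"
    unfolding E3_def by (auto intro: span_base)
  obtain y z where yz: "y \<in> Cl0" "z \<in> Cl1" "x = y + z" by (rule Cl_decomp)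
  have "f y = g y"
    by (rule linear_eq_on_span[OF lin _ yz(1)[unfolded Cl0_def]])
       (use f g e in \<open>auto simp: is_bar_def\<close>)
  moreover have "f z = g z"
    by (rule linear_eq_on_span[OF lin _ yz(2)[unfolded Cl1_def]])
       (use f g e in \<open>auto simp: is_bar_def\<close>)
  ultimately show "f x = g x"
    using lin yz(3) by (simp add: linear_add)
qed

lemma ex1_bar: "\<exists>!f. is_bar f"
  using is_bar_expl is_bar_unique by blast

lemma Cl_bar_eq: "Cl_bar = bar_expl"
  unfolding Cl_bar_def using is_bar_expl is_bar_unique by blast

lemma ex1_Cl_norm:
  assumes "x \<in> carrier Cl_hom"
  shows "\<exists>!r. Cl_bar x ** x = r *\<^sub>R mat 1"
proof -
  have "alpha_expl x = x \<or> alpha_expl x = - x"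
    using assms by (auto simp: Cl_hom_def Cl0_eq Cl1_eq)
  then have "det (alpha_expl x) = det x"
    by (auto simp: det_2)
  then have "cnj (det x) = det x"
    by (simp add: det_2 alpha_expl_def mult.commute)
  then have "Im (det x) = 0"
    by (simp add: complex_eq_iff)
  then have "Cl_bar x ** x = Re (det x) *\<^sub>R mat 1"
    by (simp add: Cl_bar_eq bar_expl_def mat2_simps det_2 complex_eq_iff algebra_simps)
  moreover have "r *\<^sub>R (mat 1 :: cmat2) = t *\<^sub>R mat 1 \<Longrightarrow> r = t" for r t
    by (simp add: mat2_simps complex_eq_iff)
  ultimately show ?thesis
    by metis
qed

lemma E3_to_su2_bij: "bij_betw ((*\<^sub>C) \<i>) E3 su2"
proof -
  have "su2 = (*\<^sub>C) \<i> ` E3"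
  proof -
    have "su2 = range su2_frame"
      using su2_frame_bij by (simp add: bij_betw_def)
    also have "\<dots> = (*\<^sub>C) \<i> ` E3"
    proof (intro equalityI subsetI)
      fix B assume "B \<in> range su2_frame"
      then obtain x where "B = su2_frame x" by blast
      then have "B = \<i> *\<^sub>C (x$1 *\<^sub>R e1 + x$2 *\<^sub>R e2 + x$3 *\<^sub>R e3)"
        by (simp add: su2_frame_def mat2_simps complex_eq_iff)
      moreover have "x$1 *\<^sub>R e1 + x$2 *\<^sub>R e2 + x$3 *\<^sub>R e3 \<in> E3"
        unfolding E3_def by (intro span_add span_scale span_base) auto
      ultimately show "B \<in> (*\<^sub>C) \<i> ` E3" by blast
    next
      fix B assume "B \<in> (*\<^sub>C) \<i> ` E3"
      then obtain v where v: "v \<in> E3" "B = \<i> *\<^sub>C v" by blast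
      then obtain a b c where "v = a *\<^sub>R e1 + b *\<^sub>R e2 + c *\<^sub>R e3"
        unfolding E3_def by (auto simp: span_insert diff_eq_eq algebra_simps)
      with v have "B = su2_frame (vector [a, b, c])"
        by (simp add: su2_frame_def mat2_simps complex_eq_iff)
      then show "B \<in> range su2_frame" by blast
    qed
    finally show ?thesis .
  qed
  then show ?thesis
    by (auto simp: bij_betw_def inj_on_def mat2_simps)
qed

end

theory Submission
  imports Defs
begin

text \<open>A nonzero \<open>w\<close> in \<open>su(2)\<close>, scaled to \<open>x = i w\<close> with \<open>det x = - 1\<close>, acts through \<^const>\<open>rho_tilde\<close> as
  the reflection along \<open>w\<close>. Every isometry of \<open>su(2)\<close> is undone by at most three such reflections, each
  restoring one more vector of an orthogonal basis, so \<^const>\<open>rho_tilde\<close> is onto; an element of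
  its kernel commutes up to sign with the Pauli matrices and is therefore \<open>\<plusminus>1\<close>. All group and sign
  statements about \<open>O(3)\<close> are pulled back along \<^const>\<open>rho_tilde\<close>. The covering property comes from compactness:
  a continuous surjection of a compact set onto a Hausdorff space whose fibres are \<open>{x, - x}\<close> is a
  covering. The Pin group turns out to be literally \<open>U(2)\<^sup>\<plusminus>\<^sup>1\<close>, because \<open>\<alpha>(x) = det x \<cdot> x\<close> there.
  Since an orthogonal reflection is determined by its \<open>- 1\<close> eigenvector, \<open>x\<close> acts as a
  reflection iff \<open>x\<close> is, up to sign, one of the elements above, that is, iff \<open>x\<close> has trace \<open>0\<close> and determinant
  \<open>- 1\<close>.\<close>

section \<open>Quotients by the antipodal map\<close>

text \<open>The orthogonal groups are sets of functions, so their topology is a product topology,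
  and products of Hausdorff spaces are Hausdorff.\<close>

lemma Hausdorff_space_euclidean_fun:
  "Hausdorff_space (euclidean :: ('a \<Rightarrow> 'b::t2_space) topology)"
proof -
  have "Hausdorff_space (euclidean :: 'b topology)"
    unfolding Hausdorff_space_def disjnt_def
    by (intro allI impI) (metis hausdorff open_openin)
  then show ?thesis
    unfolding euclidean_product_topology [symmetric] Hausdorff_space_product_topology by blast
qed

text \<open>A continuous map from a compact space to a Hausdorff space is closed. Removing
  antipodally symmetric open sets turns this into openness, and a ball that misses its antipode then
  gives an evenly covered neighbourhood with two sheets.\<close>

lemma covering_space_antipodal:
  fixes S :: "'a::real_normed_vector set" and T :: "'b::topological_space set"
  assumes S: "compact S" "0 \<notin> S" "uminus ` S \<subseteq> S"
    and T: "Hausdorff_space (top_of_set T)"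
    and p: "continuous_on S p" "p ` S = T"
    and fib: "\<And>x y. x \<in> S \<Longrightarrow> y \<in> S \<Longrightarrow> p x = p y \<longleftrightarrow> x = y \<or> x = - y"
  shows "covering_space S p T"
proof
  show "continuous_on S p" "p ` S = T" by fact+
  have neg: "- x \<in> S \<longleftrightarrow> x \<in> S" for x
    using S(3) by (metis imageI minus_minus subsetD)
  have open_neg: "openin (top_of_set S) (uminus ` W)" if "openin (top_of_set S) W" for W
  proof -
    have "homeomorphism S S uminus uminus"
      by (auto simp: homeomorphism_def neg intro!: continuous_intros) (metis imageI neg minus_minus)+
    then show ?thesis
      using that homeomorphism_imp_open_map by blast
  qed
  have closed: "closed_map (top_of_set S) (top_of_set T) p"
    using S(1) T p by (intro continuous_imp_closed_map) (auto simp: compact_space_subtopology)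
  have open_im: "openin (top_of_set T) (p ` W)" if W: "openin (top_of_set S) W" for W
  proof -
    have "W \<subseteq> S" using W openin_imp_subset by blast
    \<comment> \<open>Closedness of \<open>p\<close> says nothing about the image of an open set
      directly. After symmetrizing \<open>W\<close>, the image of the complement is exactly the
      complement of the image.\<close>
    have "closedin (top_of_set S) (S - (W \<union> uminus ` W))"
      using W open_neg by (intro closedin_diff openin_Un) auto
    then have "closedin (top_of_set T) (p ` (S - (W \<union> uminus ` W)))"
      using closed by (auto simp: closed_map_def)
    then have "openin (top_of_set T) (T - p ` (S - (W \<union> uminus ` W)))"
      by (simp add: openin_diff)
    also have "T - p ` (S - (W \<union> uminus ` W)) = p ` W"
    proof (intro equalityI subsetI)
      fix y assume "y \<in> T - p ` (S - (W \<union> uminus ` W))"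
      then obtain x where x: "x \<in> S" "y = p x"
        using p(2) by blast
      moreover have "p x \<notin> p ` (S - (W \<union> uminus ` W))"
        using \<open>y \<in> T - _\<close> \<open>y = p x\<close> by simp
      ultimately have "x \<in> W \<union> uminus ` W"
        by (meson DiffI imageI)
      with x show "y \<in> p ` W"
        using \<open>W \<subseteq> S\<close> fib by (metis UnE imageE imageI minus_minus subsetD)
    next
      fix y assume "y \<in> p ` W"
      then obtain x where x: "x \<in> W" "y = p x" by blast
      moreover have "p x \<noteq> p z" if "z \<in> S - (W \<union> uminus ` W)" for z
        using that x \<open>W \<subseteq> S\<close> fib by (metis DiffE UnI1 UnI2 imageI minus_minus subsetD)
      ultimately show "y \<in> T - p ` (S - (W \<union> uminus ` W))"
        using p(2) \<open>W \<subseteq> S\<close> by auto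
    qed
    finally show ?thesis .
  qed
  fix y assume "y \<in> T"
  then obtain x where x: "x \<in> S" "y = p x" using p(2) by blast
  \<comment> \<open>With radius \<open>norm x\<close>, having both \<open>z\<close> and
    \<open>- z\<close> in the ball would give \<open>norm (2 *\<^sub>R x) < 2 * norm x\<close>. The
    radius is positive because \<open>S\<close> avoids \<open>0\<close>.\<close>
  define W where "W = S \<inter> ball x (norm x)"
  have W: "openin (top_of_set S) W" "W \<subseteq> S"
    by (auto simp: W_def openin_open_Int)
  have xW: "x \<in> W" using x S(2) by (auto simp: W_def)
  have disj: "W \<inter> uminus ` W = {}"
  proof -
    have False if "z \<in> W" "- z \<in> W" for z
    proof -
      have "norm (x - z) < norm x" "norm (x + z) < norm x"
        using that by (auto simp: W_def dist_norm)
      moreover have "norm (2 *\<^sub>R x) \<le> norm (x - z) + norm (x + z)"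
        using norm_triangle_ineq[of "x - z" "x + z"] by (simp add: scaleR_2)
      ultimately show False by simp
    qed
    then show ?thesis by auto
  qed
  \<comment> \<open>Stated for a general \<open>V\<close> so that it serves both sheets,
    \<open>W\<close> and its antipode, which have the same image.\<close>
  have homeo: "\<exists>q. homeomorphism V (p ` W) p q"
    if V: "openin (top_of_set S) V" "p ` V = p ` W" "V \<inter> uminus ` V = {}" for V
  proof -
    have "V \<subseteq> S" using V(1) openin_imp_subset by blast
    have "inj_on p V"
      using \<open>V \<subseteq> S\<close> V(3) fib by (intro inj_onI) blast
    moreover have "openin (top_of_set (p ` W)) (p ` U)" if "openin (top_of_set V) U" for U
      using that V open_im[of U] openin_trans[OF that V(1)]
      by (metis image_mono open_im openin_imp_subset openin_subset_trans p(2) W(2))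
    ultimately show ?thesis
      using homeomorphism_injective_open_map[of V p "p ` W"] V(2) p(1) \<open>V \<subseteq> S\<close>
      by (metis continuous_on_subset)
  qed
  have img: "p ` uminus ` W = p ` W"
  proof -
    have "p (- z) = p z" if "z \<in> W" for z
      using that W(2) fib neg by blast
    then show ?thesis by (simp add: image_image)
  qed
  show "\<exists>U. y \<in> U \<and> openin (top_of_set T) U \<and>
      (\<exists>v. \<Union> v = S \<inter> p -` U \<and> (\<forall>u\<in>v. openin (top_of_set S) u) \<and>
        pairwise disjnt v \<and> (\<forall>u\<in>v. \<exists>q. homeomorphism u U p q))"
  proof (intro exI[of _ "p ` W"] exI[of _ "{W, uminus ` W}"] conjI)
    show "y \<in> p ` W" using x xW by blast
    show "openin (top_of_set T) (p ` W)" using W open_im by blast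
    show "\<Union> {W, uminus ` W} = S \<inter> p -` p ` W"
    proof (intro equalityI subsetI)
      fix z assume "z \<in> \<Union> {W, uminus ` W}"
      then have "z \<in> S" "p z \<in> p ` W \<union> p ` uminus ` W"
        using W(2) neg by auto
      then show "z \<in> S \<inter> p -` p ` W"
        unfolding img by simp
    next
      fix z assume "z \<in> S \<inter> p -` p ` W"
      then obtain u where u: "z \<in> S" "u \<in> W" "p z = p u" by blast
      then have "z = u \<or> z = - u"
        using fib[of z u] W(2) by blast
      with u(2) show "z \<in> \<Union> {W, uminus ` W}"
        by blast
    qed
    show "\<forall>u\<in>{W, uminus ` W}. openin (top_of_set S) u"
      using W open_neg by auto
    show "pairwise disjnt {W, uminus ` W}"
      using disj by (auto simp: pairwise_insert disjnt_def)
    have "uminus ` W \<inter> uminus ` uminus ` W = {}"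
      using disj by (simp add: image_image Int_commute)
    then show "\<forall>u\<in>{W, uminus ` W}. \<exists>q. homeomorphism u (p ` W) p q"
      using homeo[OF W(1) refl disj] homeo[OF open_neg[OF W(1)] img] by simp
  qed
qed

lemma continuous_on_cmat2I:
  fixes f :: "'a::topological_space \<Rightarrow> cmat2"
  assumes "\<And>i j. continuous_on S (\<lambda>x. f x $ i $ j)"
  shows "continuous_on S f"
proof -
  have "continuous_on S (\<lambda>x. \<chi> i j. f x $ i $ j)"
    by (intro continuous_on_vec_lambda assms)
  then show ?thesis by simp
qed

section \<open>The unitary groups\<close>

lemma ctranspose_nth [simp]: "ctranspose A $ i $ j = cnj (A $ j $ i)"
  by (simp add: ctranspose_def transpose_def)

lemma su2_iff:
  "B \<in> su2 \<longleftrightarrow> Re (B$1$1) = 0 \<and> Re (B$2$2) = 0 \<and> Im (B$2$2) = - Im (B$1$1) \<and>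
     Re (B$2$1) = - Re (B$1$2) \<and> Im (B$2$1) = Im (B$1$2)"
  by (auto simp: su2_def trace_def sum_2 cmat2_eq_iff complex_eq_iff)

lemma subspace_su2: "subspace su2"
  by (simp add: subspace_def su2_iff mat2_simps)

lemma inner_cmat2:
  "(A :: cmat2) \<bullet> B = A$1$1 \<bullet> B$1$1 + A$1$2 \<bullet> B$1$2 + A$2$1 \<bullet> B$2$1 + A$2$2 \<bullet> B$2$2"
  by (simp add: inner_vec_def sum_2)

text \<open>In \<open>su2\<close> the two diagonal entries have equal modulus, and so do the two
  off-diagonal ones. The ambient inner product therefore counts everything twice, which is the
  source of each later factor \<open>2\<close> or \<open>sqrt 2\<close>.\<close>

lemma det_su2: "B \<in> su2 \<Longrightarrow> det B = complex_of_real ((B \<bullet> B) / 2)"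
  by (auto simp: su2_iff det_2 inner_cmat2 inner_complex_def complex_eq_iff)

lemma invertible_cmat2: "invertible (A :: cmat2) \<longleftrightarrow> det A \<noteq> 0"
  by (simp add: invertible_det_nz)

text \<open>The inverse is the adjoint by unitarity and also the adjugate divided by the
  determinant. Comparing the two expresses the second row through the first, with \<open>d\<close>
  the determinant.\<close>

lemma U2pm_iff:
  "A \<in> carrier U2pm \<longleftrightarrow> (\<exists>a b d. A = mat2 a b (- d * cnj b) (d * cnj a) \<and>
     a * cnj a + b * cnj b = 1 \<and> d \<in> {1, - 1})" (is "?l \<longleftrightarrow> ?r")
proof
  assume ?l
  then have u: "A ** ctranspose A = mat 1" and d: "det A = 1 \<or> det A = - 1"
    by (auto simp: U2pm_def)
  from u have e: "A$1$1 * cnj (A$1$1) + A$1$2 * cnj (A$1$2) = 1"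
      "A$1$1 * cnj (A$2$1) + A$1$2 * cnj (A$2$2) = 0"
      "A$2$1 * cnj (A$1$1) + A$2$2 * cnj (A$1$2) = 0"
    by (auto simp: mat2_simps)
  have de: "det A = A$1$1 * A$2$2 - A$1$2 * A$2$1" by (simp add: det_2)
  \<comment> \<open>For the first identity, expand \<open>det A * cnj (A$1$1)\<close>, trade
    \<open>A$2$1 * cnj (A$1$1)\<close> for \<open>- A$2$2 * cnj (A$1$2)\<close> and use that the
    first row has norm one. The second is analogous.\<close>
  have "A$2$2 = det A * cnj (A$1$1)" "A$2$1 = - det A * cnj (A$1$2)"
    using e unfolding de by algebra+
  then have "A = mat2 (A$1$1) (A$1$2) (- det A * cnj (A$1$2)) (det A * cnj (A$1$1))"
    unfolding cmat2_eq_iff mat2_nth by simp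
  with e d show ?r by blast
next
  assume ?r
  then obtain a b d where A: "A = mat2 a b (- d * cnj b) (d * cnj a)"
      and ab: "a * cnj a + b * cnj b = 1" and d: "d = 1 \<or> d = - 1" by blast
  have "det A = d * (a * cnj a + b * cnj b)"
    by (simp add: A det_2 algebra_simps)
  with ab have "det A = d" by simp
  moreover have "A ** ctranspose A = mat 1"
    using ab d by (auto simp: A mat2_simps algebra_simps)
  ultimately show ?l
    using d by (auto simp: U2pm_def invertible_cmat2)
qed

lemma U2pmE:
  assumes "A \<in> carrier U2pm"
  obtains a b d where "A = mat2 a b (- d * cnj b) (d * cnj a)" "a * cnj a + b * cnj b = 1"
    "d = 1 \<or> d = - 1" "det A = d"
proof -
  obtain a b d where A: "A = mat2 a b (- d * cnj b) (d * cnj a)"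
      and ab: "a * cnj a + b * cnj b = 1" and d: "d = 1 \<or> d = - 1"
    using assms U2pm_iff by auto
  have "det A = d * (a * cnj a + b * cnj b)"
    by (simp add: A det_2 algebra_simps)
  with ab d A that show ?thesis by simp
qed

lemma U2pm_simps [simp]: "mult U2pm = (**)" "one U2pm = mat 1"
  by (simp_all add: U2pm_def)

lemma U2pm_unitary: "A \<in> carrier U2pm \<Longrightarrow> A ** ctranspose A = mat 1"
  by (simp add: U2pm_def)

lemma U2pm_det: "A \<in> carrier U2pm \<Longrightarrow> det A = 1 \<or> det A = - 1"
  by (auto simp: U2pm_def)

lemma matrix_inv_eqI:
  fixes A :: "'a::field^'n^'n"
  assumes "A ** B = mat 1"
  shows "matrix_inv A = B"
  unfolding matrix_inv_def
proof (rule some_equality)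
  show "A ** B = mat 1 \<and> B ** A = mat 1"
    using assms matrix_left_right_inverse by blast
  show "C = B" if "A ** C = mat 1 \<and> C ** A = mat 1" for C
  proof -
    have "C = C ** (A ** B)" using assms by simp
    also have "\<dots> = B" using that by (simp add: matrix_mul_assoc)
    finally show ?thesis .
  qed
qed

lemma U2pm_inv: "A \<in> carrier U2pm \<Longrightarrow> matrix_inv A = ctranspose A"
  by (rule matrix_inv_eqI) (rule U2pm_unitary)

lemma ctranspose_mult: "ctranspose (A ** B) = ctranspose B ** ctranspose A"
  by (simp add: mat2_simps mult.commute)

lemma det_ctranspose: "det (ctranspose A) = cnj (det A)"
  by (simp add: det_2 mult.commute)

lemma U2pmI: "A ** ctranspose A = mat 1 \<Longrightarrow> det A = 1 \<or> det A = - 1 \<Longrightarrow> A \<in> carrier U2pm"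
  by (auto simp: U2pm_def invertible_cmat2)

lemma group_U2pm: "group U2pm"
proof (rule groupI)
  fix A B assume AB: "A \<in> carrier U2pm" "B \<in> carrier U2pm"
  show "A \<otimes>\<^bsub>U2pm\<^esub> B \<in> carrier U2pm"
  proof (rule U2pmI)
    have "(A ** B) ** ctranspose (A ** B) = A ** (B ** ctranspose B) ** ctranspose A"
      by (simp add: ctranspose_mult matrix_mul_assoc)
    then show "(A \<otimes>\<^bsub>U2pm\<^esub> B) ** ctranspose (A \<otimes>\<^bsub>U2pm\<^esub> B) = mat 1"
      using AB by (simp add: U2pm_unitary)
    show "det (A \<otimes>\<^bsub>U2pm\<^esub> B) = 1 \<or> det (A \<otimes>\<^bsub>U2pm\<^esub> B) = - 1"
      using AB[THEN U2pm_det] by (auto simp: det_mul)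
  qed
next
  show "\<one>\<^bsub>U2pm\<^esub> \<in> carrier U2pm"
    by (rule U2pmI) (simp_all add: mat2_simps)
next
  fix A assume A: "A \<in> carrier U2pm"
  have "ctranspose A ** A = mat 1"
    using U2pm_unitary[OF A] matrix_left_right_inverse by blast
  moreover have "ctranspose (ctranspose A) = A" by (simp add: mat2_simps)
  ultimately have "ctranspose A \<in> carrier U2pm"
    using U2pm_det[OF A] by (intro U2pmI) (auto simp: det_ctranspose)
  with \<open>ctranspose A ** A = mat 1\<close> show "\<exists>B\<in>carrier U2pm. B \<otimes>\<^bsub>U2pm\<^esub> A = \<one>\<^bsub>U2pm\<^esub>"
    by auto
qed (auto simp: matrix_mul_assoc)

lemma group_sign: "group sign_group"
  by (rule groupI) (auto simp: sign_group_def)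

lemma det_hom: "det \<in> hom U2pm sign_group"
  by (auto simp: hom_def sign_group_def det_mul dest: U2pm_det)

lemma uminus_U2pm: "- A \<in> carrier U2pm \<longleftrightarrow> A \<in> carrier U2pm"
proof -
  have "- A \<in> carrier U2pm" if "A \<in> carrier U2pm" for A
    using U2pm_unitary[OF that] U2pm_det[OF that]
    by (intro U2pmI) (auto simp: mat2_simps det_2)
  from this[of A] this[of "- A"] show ?thesis by auto
qed

lemma subgroup_SU2: "subgroup (carrier SU2) U2pm"
proof -
  interpret group_hom U2pm sign_group det
    by (simp add: group_hom_def group_hom_axioms_def group_U2pm group_sign det_hom)
  have "carrier SU2 = kernel U2pm sign_group det"
    by (auto simp: SU2_def kernel_def sign_group_def)
  then show ?thesis using subgroup_kernel by simp
qed

lemma group_SU2: "group SU2"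
  using group.subgroup_imp_group[OF group_U2pm subgroup_SU2] by (simp add: SU2_def)

lemma pm_id_subset: "{mat 1, - mat 1} \<subseteq> carrier SU2"
  by (auto simp: SU2_def uminus_U2pm det_2 mat_nth group.is_monoid[OF group_U2pm]
      monoid.one_closed[OF group.is_monoid[OF group_U2pm], simplified])

lemma group_pm_id: "group pm_id_group"
  by (rule groupI) (auto simp: pm_id_group_def mat2_simps)

section \<open>Topology of the unitary groups\<close>

lemma compact_U2pm: "compact (carrier U2pm)"
proof -
  have eq: "carrier U2pm = {A. A ** ctranspose A = mat 1} \<inter> {A. (det A)\<^sup>2 = 1}"
    by (auto simp: power2_eq_1_iff dest: U2pm_unitary U2pm_det intro!: U2pmI)
  have "continuous_on UNIV (\<lambda>A. A ** ctranspose A)"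
    by (rule continuous_on_cmat2I) (auto simp: mult2_nth intro!: continuous_intros)
  then have "closed {A. A ** ctranspose A = mat 1}"
    by (intro closed_Collect_eq) (auto intro!: continuous_intros)
  moreover have "closed {A::cmat2. (det A)\<^sup>2 = 1}"
    unfolding det_2 by (intro closed_Collect_eq) (auto intro!: continuous_intros)
  \<comment> \<open>The diagonal entries of \<open>A ** ctranspose A\<close> are the squared norms
    of the two rows.\<close>
  moreover have "A \<bullet> A = 2" if "A \<in> carrier U2pm" for A
  proof -
    have "Re ((A ** ctranspose A)$1$1) = 1" "Re ((A ** ctranspose A)$2$2) = 1"
      using U2pm_unitary[OF that] by (simp_all add: mat_nth)
    then show ?thesis by (simp add: mult2_nth inner_cmat2 inner_complex_def)
  qed
  then have "bounded (carrier U2pm)"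
    by (auto simp: bounded_iff norm_eq_sqrt_inner)
  ultimately show ?thesis
    unfolding compact_eq_bounded_closed eq by blast
qed

lemma compact_SU2: "compact (carrier SU2)"
proof -
  have "closed {A::cmat2. det A = 1}"
    unfolding det_2 by (intro closed_Collect_eq) (auto intro!: continuous_intros)
  then have "compact (carrier U2pm \<inter> {A. det A = 1})"
    using compact_U2pm by blast
  also have "carrier U2pm \<inter> {A. det A = 1} = carrier SU2"
    by (auto simp: SU2_def)
  finally show ?thesis .
qed

text \<open>The first row determines a special unitary matrix and ranges over the unit sphere of
  \<open>complex \<times> complex\<close>, a 3-sphere. A continuous bijection from a compact set
  onto it is a homeomorphism.\<close>

lemma simply_connected_SU2: "simply_connected (carrier SU2)"
proof -
  define h where "h = (\<lambda>A::cmat2. (A$1$1, A$1$2))"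
  have SU2_eq: "carrier SU2 = {mat2 a b (- cnj b) (cnj a) | a b. a * cnj a + b * cnj b = 1}"
  proof (intro equalityI subsetI)
    fix A assume "A \<in> carrier SU2"
    then have "A \<in> carrier U2pm" "det A = 1" by (simp_all add: SU2_def)
    then show "A \<in> {mat2 a b (- cnj b) (cnj a) | a b. a * cnj a + b * cnj b = 1}"
      by (elim U2pmE) auto
  next
    fix A assume "A \<in> {mat2 a b (- cnj b) (cnj a) | a b. a * cnj a + b * cnj b = 1}"
    then obtain a b where "A = mat2 a b (- 1 * cnj b) (1 * cnj a)" "a * cnj a + b * cnj b = 1"
      by auto
    moreover from this have "A \<in> carrier U2pm" unfolding U2pm_iff by blast
    ultimately show "A \<in> carrier SU2"
      by (simp add: SU2_def det_2)
  qed
  have norm1: "norm (a, b) = 1 \<longleftrightarrow> a * cnj a + b * cnj b = 1" for a b :: complex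
    unfolding norm_Pair complex_norm_square[symmetric] of_real_add[symmetric] of_real_eq_1_iff by simp
  have "h ` carrier SU2 = sphere 0 1"
  proof (intro equalityI subsetI)
    fix z assume "z \<in> h ` carrier SU2"
    then show "z \<in> sphere 0 1" by (auto simp: SU2_eq h_def norm1)
  next
    fix z :: "complex \<times> complex" assume "z \<in> sphere 0 1"
    then obtain a b where "z = (a, b)" "a * cnj a + b * cnj b = 1"
      using norm1 by (cases z) auto
    then have "mat2 a b (- cnj b) (cnj a) \<in> carrier SU2" "z = h (mat2 a b (- cnj b) (cnj a))"
      by (auto simp: SU2_eq h_def)
    then show "z \<in> h ` carrier SU2" by blast
  qed
  moreover have "continuous_on (carrier SU2) h"
    unfolding h_def by (intro continuous_intros)
  moreover have "inj_on h (carrier SU2)"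
    by (auto simp: inj_on_def SU2_eq h_def)
  ultimately have "carrier SU2 homeomorphic (sphere 0 1 :: (complex \<times> complex) set)"
    using compact_SU2 homeomorphism_compact homeomorphic_def by metis
  from homeomorphic_simply_connected_eq[OF this] show ?thesis
    by (simp add: simply_connected_sphere)
qed

section \<open>The action on \<open>su(2)\<close>\<close>

lemma cscale_mult: "(c *\<^sub>C A) ** B = c *\<^sub>C (A ** B)" "A ** (c *\<^sub>C B) = c *\<^sub>C (A ** B)"
  by (simp_all add: mat2_simps algebra_simps)

lemma cscale_cscale: "c *\<^sub>C d *\<^sub>C A = (c * d) *\<^sub>C A"
  by (simp add: mat2_simps)

lemma scaleR_cscale: "r *\<^sub>R A = complex_of_real r *\<^sub>C A"
  by (simp add: cmat2_eq_iff scaleR_conv_of_real[where 'a = complex])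

lemma cscale_1 [simp]: "1 *\<^sub>C A = A"
  by (simp add: mat2_simps)

lemma det_cscale: "det (c *\<^sub>C A) = c\<^sup>2 * det A"
  by (simp add: det_2 power2_eq_square algebra_simps)

lemma rho_tilde_apply:
  "A \<in> carrier U2pm \<Longrightarrow> B \<in> su2 \<Longrightarrow> rho_tilde A B = det A *\<^sub>C (A ** B ** ctranspose A)"
  by (simp add: rho_tilde_def U2pm_inv)

text \<open>The factor \<open>det A\<close> is a real sign, hence harmless for skew-hermitian
  matrices, and conjugation preserves the trace by cyclicity.\<close>

lemma rho_tilde_in_su2:
  assumes A: "A \<in> carrier U2pm" and B: "B \<in> su2"
  shows "rho_tilde A B \<in> su2"
proof -
  have "ctranspose (det A *\<^sub>C (A ** B ** ctranspose A)) = det A *\<^sub>C (A ** ctranspose B ** ctranspose A)"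
    using U2pm_det[OF A] by (auto simp: mat2_simps algebra_simps)
  also have "\<dots> = - (det A *\<^sub>C (A ** B ** ctranspose A))"
    using B by (simp add: su2_def) (simp add: mat2_simps algebra_simps)
  finally have 1: "ctranspose (rho_tilde A B) = - rho_tilde A B"
    using A B by (simp add: rho_tilde_apply)
  have "trace (A ** B ** ctranspose A) = trace (ctranspose A ** A ** B)"
    by (metis trace_mul_sym matrix_mul_assoc)
  also have "\<dots> = trace B"
    using U2pm_unitary[OF A] by (metis matrix_left_right_inverse matrix_mul_lid)
  finally have "trace (rho_tilde A B) = 0"
    using A B by (simp add: rho_tilde_apply su2_def trace_def sum_2 flip: distrib_left)
  with 1 show ?thesis by (simp add: su2_def)
qed

lemma rho_tilde_linear: "A \<in> carrier U2pm \<Longrightarrow> linear_on_set scaleR scaleR su2 (rho_tilde A)"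
  using subspace_su2
  by (auto simp: linear_on_set_def rho_tilde_apply subspace_add subspace_scale mat2_simps algebra_simps)

lemma det_rho_tilde:
  assumes "A \<in> carrier U2pm" "B \<in> su2"
  shows "det (rho_tilde A B) = det B"
  using assms U2pm_det[OF assms(1)]
  by (auto simp: rho_tilde_apply det_cscale det_mul det_ctranspose)

lemma rho_tilde_one: "rho_tilde (mat 1) = (\<lambda>B\<in>su2. B)"
proof -
  have "mat 1 \<in> carrier U2pm"
    using pm_id_subset by (auto simp: SU2_def)
  then show ?thesis
    by (auto simp: rho_tilde_def U2pm_inv det_2 mat_nth restrict_def fun_eq_iff mat2_simps)
qed

lemma rho_tilde_extensional: "rho_tilde A \<in> extensional su2"
  by (simp add: rho_tilde_def)

lemma rho_tilde_mult_apply: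
  assumes "A \<in> carrier U2pm" "B \<in> carrier U2pm" "X \<in> su2"
  shows "rho_tilde (A ** B) X = rho_tilde A (rho_tilde B X)"
proof -
  have "A ** B \<in> carrier U2pm"
    using assms monoid.m_closed[OF group.is_monoid[OF group_U2pm]] by simp
  moreover have "rho_tilde B X \<in> su2"
    using assms by (simp add: rho_tilde_in_su2)
  ultimately have "rho_tilde (A ** B) X = det (A ** B) *\<^sub>C (A ** B ** X ** ctranspose (A ** B))"
      "rho_tilde A (rho_tilde B X) = det A *\<^sub>C (A ** (det B *\<^sub>C (B ** X ** ctranspose B)) ** ctranspose A)"
    using assms by (simp_all add: rho_tilde_apply)
  then show ?thesis
    by (simp add: det_mul ctranspose_mult cscale_mult cscale_cscale matrix_mul_assoc)
qed

text \<open>Phrased pointwise, because at this stage \<open>O3\<close> is not yet known to be a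
  group.\<close>

lemma rho_tilde_inv_apply:
  assumes "A \<in> carrier U2pm"
  shows "\<exists>B\<in>carrier U2pm. \<forall>X\<in>su2. rho_tilde A (rho_tilde B X) = X \<and> rho_tilde B (rho_tilde A X) = X"
proof -
  obtain B where "B \<in> carrier U2pm" "A ** B = mat 1" "B ** A = mat 1"
    using group.Units_eq[OF group_U2pm] assms by (force simp: Units_def)
  then show ?thesis
    using assms by (auto simp: rho_tilde_one intro!: bexI[of _ B] simp flip: rho_tilde_mult_apply)
qed

lemma rho_tilde_Bij:
  assumes "A \<in> carrier U2pm"
  shows "rho_tilde A \<in> Bij su2"
proof -
  obtain B where "B \<in> carrier U2pm"
      "\<forall>X\<in>su2. rho_tilde A (rho_tilde B X) = X \<and> rho_tilde B (rho_tilde A X) = X"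
    using rho_tilde_inv_apply[OF assms] by blast
  then have "bij_betw (rho_tilde A) su2 su2"
    using assms rho_tilde_in_su2 by (intro bij_betwI[where g = "rho_tilde B"]) auto
  then show ?thesis by (simp add: Bij_def rho_tilde_extensional)
qed

lemma O3_iff:
  "f \<in> carrier O3 \<longleftrightarrow> f \<in> Bij su2 \<and> linear_on_set scaleR scaleR su2 f \<and> (\<forall>v\<in>su2. det (f v) = det v)"
  by (simp add: O3_def orthogonal_group_def)

lemma rho_tilde_O3: "A \<in> carrier U2pm \<Longrightarrow> rho_tilde A \<in> carrier O3"
  by (simp add: O3_iff rho_tilde_Bij rho_tilde_linear det_rho_tilde)

lemma rho_tilde_hom: "rho_tilde \<in> hom U2pm O3"
proof (rule homI)
  fix A B assume AB: "A \<in> carrier U2pm" "B \<in> carrier U2pm"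
  have "rho_tilde (A ** B) = compose su2 (rho_tilde A) (rho_tilde B)"
  proof (rule extensionalityI[of _ su2])
    show "rho_tilde (A ** B) X = compose su2 (rho_tilde A) (rho_tilde B) X" if "X \<in> su2" for X
      using that AB by (simp add: rho_tilde_mult_apply compose_eq)
  qed (simp_all add: rho_tilde_extensional)
  then show "rho_tilde (A \<otimes>\<^bsub>U2pm\<^esub> B) = rho_tilde A \<otimes>\<^bsub>O3\<^esub> rho_tilde B"
    using AB by (simp add: O3_def orthogonal_group_def BijGroup_def rho_tilde_Bij)
qed (rule rho_tilde_O3)

lemma pauli_su2: "\<i> *\<^sub>C e1 \<in> su2" "\<i> *\<^sub>C e2 \<in> su2" "\<i> *\<^sub>C e3 \<in> su2"
  by (simp_all add: su2_iff)

text \<open>For determinant one, \<open>A\<close> commutes with the Pauli matrices and is a scalar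
  of modulus one that must be real. For determinant \<open>- 1\<close>, it anticommutes with all
  three, which only the zero matrix does.\<close>

lemma rho_tilde_kernel:
  assumes A: "A \<in> carrier U2pm" and id: "\<And>B. B \<in> su2 \<Longrightarrow> rho_tilde A B = B"
  shows "A = mat 1 \<or> A = - mat 1"
proof -
  have comm: "det A *\<^sub>C (A ** B) = B ** A" if "B \<in> su2" for B
  proof -
    have "B ** A = det A *\<^sub>C (A ** B ** (ctranspose A ** A))"
      using id[OF that] that A by (simp add: rho_tilde_apply) (metis cscale_mult(1) matrix_mul_assoc)
    moreover have "ctranspose A ** A = mat 1"
      using U2pm_unitary[OF A] matrix_left_right_inverse by blast
    ultimately show ?thesis by simp
  qed
  obtain a b d where d: "A = mat2 a b (- d * cnj b) (d * cnj a)" "a * cnj a + b * cnj b = 1"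
      "d = 1 \<or> d = - 1" "det A = d"
    using U2pmE[OF A] by metis
  note c = pauli_su2[THEN comm, unfolded d(1) d(4)[unfolded d(1)]]
  from d(3) show ?thesis
  proof
    assume [simp]: "d = 1"
    have "b = 0" "a = cnj a" using c by (auto simp: mat2_simps complex_eq_iff)
    with d(2) have "a = 1 \<or> a = - 1"
      by (metis add.right_neutral mult_zero_left square_eq_1_iff)
    then show ?thesis using \<open>b = 0\<close> by (auto simp: d(1) mat2_simps)
  next
    assume [simp]: "d = - 1"
    have "a = 0" "b = 0" using c by (auto simp: mat2_simps complex_eq_iff)
    then show ?thesis using d(2) by simp
  qed
qed

section \<open>Elements acting as reflections\<close>

text \<open>Since \<open>det w\<close> is half of the squared norm, the real factor scales
  \<open>w\<close> to determinant \<open>1\<close>, and the factor \<open>\<i>\<close> changes this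
  to \<open>- 1\<close>.\<close>

definition reflection_elt :: "cmat2 \<Rightarrow> cmat2" where
  "reflection_elt w = (complex_of_real (sqrt 2 / norm w) * \<i>) *\<^sub>C w"

lemma reflection_elt:
  assumes "w \<in> su2" "w \<noteq> 0"
  shows "reflection_elt w \<in> carrier U2pm" "det (reflection_elt w) = - 1"
    "trace (reflection_elt w) = 0"
proof -
  show det: "det (reflection_elt w) = - 1"
    using assms by (simp add: reflection_elt_def det_cscale det_su2 power_mult_distrib power_divide
        flip: of_real_power) (simp add: power2_norm_eq_inner)
  show trace: "trace (reflection_elt w) = 0"
    using assms by (simp add: reflection_elt_def trace_def sum_2 su2_iff complex_eq_iff)
  have "ctranspose (reflection_elt w) = reflection_elt w"
    using assms by (simp add: reflection_elt_def mat2_simps su2_iff complex_eq_iff)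
  \<comment> \<open>This is Cayley-Hamilton. As the element is also hermitian, it is its own adjoint
    and inverse, hence unitary.\<close>
  moreover have "X ** X = mat 1" if "trace X = 0" "det X = - 1" for X :: cmat2
  proof -
    have "X$2$2 = - X$1$1" "X$1$1 * X$2$2 - X$1$2 * X$2$1 = - 1"
      using that by (simp_all add: trace_def sum_2 det_2 eq_neg_iff_add_eq_0 add.commute)
    then show ?thesis by (auto simp: mat2_simps algebra_simps)
  qed
  ultimately show "reflection_elt w \<in> carrier U2pm"
    using det trace by (intro U2pmI) auto
qed

text \<open>This is the Clifford relation: polarizing
  \<open>w ** w = - det w *\<^sub>C mat 1\<close> gives
  \<open>w ** B + B ** w = - (w \<bullet> B) *\<^sub>R mat 1\<close>, and multiplying by
  \<open>w\<close> on the right yields the claim. The proof compares coordinates.\<close>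

lemma su2_sandwich:
  assumes "w \<in> su2" "B \<in> su2"
  shows "w ** B ** w = ((w \<bullet> w) / 2) *\<^sub>R B - (w \<bullet> B) *\<^sub>R w"
  using assms
  by (auto simp: su2_iff cmat2_eq_iff mult2_nth inner_cmat2 inner_complex_def complex_eq_iff)
     (auto simp: algebra_simps)

lemma rho_tilde_reflection_elt:
  assumes w: "w \<in> su2" "w \<noteq> 0" and B: "B \<in> su2"
  shows "rho_tilde (reflection_elt w) B = B - (2 * ((w \<bullet> B) / (w \<bullet> w))) *\<^sub>R w"
proof -
  let ?c = "sqrt 2 / norm w"
  have "ctranspose (reflection_elt w) = reflection_elt w"
    using w by (simp add: reflection_elt_def mat2_simps su2_iff complex_eq_iff)
  then have "rho_tilde (reflection_elt w) B = (- 1) *\<^sub>C (reflection_elt w ** B ** reflection_elt w)"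
    using w B reflection_elt by (simp add: rho_tilde_apply)
  also have "\<dots> = ?c\<^sup>2 *\<^sub>R (w ** B ** w)"
  proof -
    \<comment> \<open>The sign from the square of \<open>\<i>\<close> cancels the sign from the
      determinant.\<close>
    have "(complex_of_real ?c * \<i>)\<^sup>2 = - complex_of_real (?c\<^sup>2)"
      by (simp add: power_mult_distrib power_divide flip: of_real_power)
    then show ?thesis
      unfolding reflection_elt_def cscale_mult cscale_cscale scaleR_cscale
      by (simp add: power2_eq_square[symmetric] mult.assoc[symmetric])
  qed
  also have "?c\<^sup>2 = 2 / (w \<bullet> w)"
    by (simp add: power_divide power2_norm_eq_inner)
  finally show ?thesis
    using w B by (simp add: su2_sandwich scaleR_diff_right)
qed

section \<open>Surjectivity onto \<open>O(3)\<close>\<close>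

lemma linear_on_su2:
  assumes "linear_on_set scaleR scaleR su2 f" "u \<in> su2" "v \<in> su2"
  shows "f (u + v) = f u + f v" "f (r *\<^sub>R u) = r *\<^sub>R f u" "f (u - v) = f u - f v"
proof -
  show "f (u + v) = f u + f v" "f (r *\<^sub>R u) = r *\<^sub>R f u" for r
    using assms by (simp_all add: linear_on_set_def)
  have "u - v \<in> su2" using assms(2,3) subspace_su2 by (simp add: subspace_diff)
  with assms(1,3) have "f (u - v + v) = f (u - v) + f v"
    unfolding linear_on_set_def by blast
  then show "f (u - v) = f u - f v" by (simp add: eq_diff_eq)
qed

lemma O3_in_su2: "f \<in> carrier O3 \<Longrightarrow> B \<in> su2 \<Longrightarrow> f B \<in> su2"
  by (auto simp: O3_iff Bij_def bij_betw_def)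

text \<open>Polarization: an additive map preserving \<open>det\<close>, hence the squared norm,
  preserves the inner product.\<close>

lemma O3_inner:
  assumes f: "f \<in> carrier O3" and uv: "u \<in> su2" "v \<in> su2"
  shows "f u \<bullet> f v = u \<bullet> v"
proof -
  have q: "f w \<bullet> f w = w \<bullet> w" if "w \<in> su2" for w
  proof -
    have "det (f w) = det w" using f that by (simp add: O3_iff)
    then show ?thesis
      unfolding det_su2[OF that] det_su2[OF O3_in_su2[OF f that]] of_real_eq_iff by simp
  qed
  have "f (u + v) = f u + f v"
    using f uv by (simp add: O3_iff linear_on_su2)
  then show ?thesis
    using q[OF subspace_add[OF subspace_su2 uv]] q[OF uv(1)] q[OF uv(2)]
    by (simp add: inner_add_left inner_add_right inner_commute)
qed

lemma su2_frame_su2: "su2_frame x \<in> su2"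
  by (simp add: su2_frame_def su2_iff)

lemma su2_frame_expand:
  "B \<in> su2 \<Longrightarrow> B = Im (B$1$2) *\<^sub>R \<i> *\<^sub>C e1 + Re (B$1$2) *\<^sub>R \<i> *\<^sub>C e2 + Im (B$1$1) *\<^sub>R \<i> *\<^sub>C e3"
  by (simp add: su2_iff cmat2_eq_iff complex_eq_iff)

lemma linear_eq_on_su2:
  assumes "linear_on_set scaleR scaleR su2 f"
    and "f (\<i> *\<^sub>C e1) = \<i> *\<^sub>C e1" "f (\<i> *\<^sub>C e2) = \<i> *\<^sub>C e2" "f (\<i> *\<^sub>C e3) = \<i> *\<^sub>C e3"
    and "B \<in> su2"
  shows "f B = B"
proof -
  have "f (x *\<^sub>R \<i> *\<^sub>C e1 + y *\<^sub>R \<i> *\<^sub>C e2 + z *\<^sub>R \<i> *\<^sub>C e3)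
      = x *\<^sub>R \<i> *\<^sub>C e1 + y *\<^sub>R \<i> *\<^sub>C e2 + z *\<^sub>R \<i> *\<^sub>C e3" for x y z
    using assms(2-4) pauli_su2 subspace_su2
    by (simp add: linear_on_su2[OF assms(1)] subspace_add subspace_scale)
  from this[of "Im (B$1$2)" "Re (B$1$2)" "Im (B$1$1)"] show ?thesis
    by (simp only: su2_frame_expand[OF assms(5), symmetric])
qed

text \<open>For \<open>g u \<noteq> u\<close> the reflection along \<open>g u - u\<close> moves \<open>g u\<close> back to \<open>u\<close>, and it fixes every fixed
  vector of \<open>g\<close> orthogonal to \<open>u\<close>.\<close>

lemma reflect_back:
  assumes g: "\<And>v. v \<in> su2 \<Longrightarrow> g v \<in> su2" "\<And>v w. v \<in> su2 \<Longrightarrow> w \<in> su2 \<Longrightarrow> g v \<bullet> g w = v \<bullet> w"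
    and u: "u \<in> su2"
  obtains A where "A \<in> carrier U2pm" "rho_tilde A (g u) = u"
    "\<And>v. v \<in> su2 \<Longrightarrow> g v = v \<Longrightarrow> v \<bullet> u = 0 \<Longrightarrow> rho_tilde A v = v"
proof (cases "g u = u")
  case True
  have "mat 1 \<in> carrier U2pm" using pm_id_subset by (auto simp: SU2_def)
  then show ?thesis
    using that[of "mat 1"] True u by (simp add: rho_tilde_one)
next
  case False
  let ?w = "g u - u"
  have w: "?w \<in> su2" "?w \<noteq> 0"
    using False u g(1) subspace_su2 by (auto intro: subspace_diff)
  have nz: "?w \<bullet> ?w \<noteq> 0" using w by simp
  \<comment> \<open>Because \<open>g u\<close> and \<open>u\<close> have the same norm, both sides
    equal \<open>2 * (u \<bullet> u) - 2 * (g u \<bullet> u)\<close>. The reflection then subtracts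
    \<open>?w\<close> from \<open>g u\<close> exactly once.\<close>
  have "?w \<bullet> ?w = 2 * (?w \<bullet> g u)"
    using g(2)[OF u u] by (simp add: inner_diff_left inner_diff_right inner_commute)
  with nz have "2 * ((?w \<bullet> g u) / (?w \<bullet> ?w)) = 1"
    by (simp only: mult_eq_0_iff) (simp add: field_simps)
  then have "rho_tilde (reflection_elt ?w) (g u) = u"
    by (simp only: rho_tilde_reflection_elt[OF w g(1)[OF u]]) simp
  moreover have "rho_tilde (reflection_elt ?w) v = v" if "v \<in> su2" "g v = v" "v \<bullet> u = 0" for v
  proof -
    have "?w \<bullet> v = g u \<bullet> g v - u \<bullet> v"
      using that by (simp add: inner_diff_left)
    also have "\<dots> = 0" using g(2)[OF u that(1)] by simp
    finally show ?thesis
      using rho_tilde_reflection_elt[OF w that(1)] by simp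
  qed
  ultimately show ?thesis
    by (rule that[OF reflection_elt(1)[OF w]])
qed

text \<open>The basis vectors are corrected one at a time. Their orthogonality guarantees that each
  new reflection leaves the vectors already restored in place.\<close>

lemma rho_tilde_surj:
  assumes f: "f \<in> carrier O3"
  shows "f \<in> rho_tilde ` carrier U2pm"
proof -
  let ?r = rho_tilde
  interpret U: group U2pm by (rule group_U2pm)
  have orth: "(\<i> *\<^sub>C e1) \<bullet> (\<i> *\<^sub>C e2) = 0" "(\<i> *\<^sub>C e1) \<bullet> (\<i> *\<^sub>C e3) = 0" "(\<i> *\<^sub>C e2) \<bullet> (\<i> *\<^sub>C e3) = 0"
    by (simp_all add: inner_cmat2 inner_complex_def)
  note f0 = O3_in_su2[OF f] O3_inner[OF f]
  obtain A where A: "A \<in> carrier U2pm" "?r A (f (\<i> *\<^sub>C e1)) = \<i> *\<^sub>C e1"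
    using reflect_back[of f, OF f0 pauli_su2(1)] by metis
  define g where "g v = ?r A (f v)" for v
  have g0: "g v \<in> su2" if "v \<in> su2" for v
    using that f0(1) rho_tilde_in_su2[OF A(1)] by (simp add: g_def)
  have gi: "g v \<bullet> g w = v \<bullet> w" if "v \<in> su2" "w \<in> su2" for v w
    using that f0 O3_inner[OF rho_tilde_O3[OF A(1)]] by (simp add: g_def)
  have g1: "g (\<i> *\<^sub>C e1) = \<i> *\<^sub>C e1" using A(2) by (simp add: g_def)
  obtain B where B: "B \<in> carrier U2pm" "?r B (g (\<i> *\<^sub>C e2)) = \<i> *\<^sub>C e2"
      "?r B (\<i> *\<^sub>C e1) = \<i> *\<^sub>C e1"
    using reflect_back[of g, OF g0 gi pauli_su2(2)] g1 orth(1) pauli_su2(1) by metis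
  define h where "h v = ?r B (g v)" for v
  have h0: "h v \<in> su2" if "v \<in> su2" for v
    using that g0 rho_tilde_in_su2[OF B(1)] by (simp add: h_def)
  have hi: "h v \<bullet> h w = v \<bullet> w" if "v \<in> su2" "w \<in> su2" for v w
    using that g0 gi O3_inner[OF rho_tilde_O3[OF B(1)]] by (simp add: h_def)
  have h12: "h (\<i> *\<^sub>C e1) = \<i> *\<^sub>C e1" "h (\<i> *\<^sub>C e2) = \<i> *\<^sub>C e2"
    using B(2,3) g1 by (simp_all add: h_def)
  obtain C where C: "C \<in> carrier U2pm" "?r C (h (\<i> *\<^sub>C e3)) = \<i> *\<^sub>C e3"
      "?r C (\<i> *\<^sub>C e1) = \<i> *\<^sub>C e1" "?r C (\<i> *\<^sub>C e2) = \<i> *\<^sub>C e2"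
    using reflect_back[of h, OF h0 hi pauli_su2(3)] h12 orth(2,3) pauli_su2(1,2) by metis
  define D where "D = C ** (B ** A)"
  have BA: "B ** A \<in> carrier U2pm" using U.m_closed[OF B(1) A(1)] by simp
  have D: "D \<in> carrier U2pm" using U.m_closed[OF C(1) BA] by (simp add: D_def)
  have Df: "?r D (f v) = ?r C (h v)" if "v \<in> su2" for v
    using that A(1) B(1) C(1) BA f0(1)
    by (simp add: D_def h_def g_def rho_tilde_mult_apply rho_tilde_in_su2)
  have lin_f: "linear_on_set scaleR scaleR su2 f" using f by (simp add: O3_iff)
  \<comment> \<open>The composite fixes the three basis vectors, so linearity makes it the identity.
    Thus \<open>f\<close> is the action of the inverse of \<open>D\<close>.\<close>
  have "linear_on_set scaleR scaleR su2 (\<lambda>v. ?r D (f v))"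
    using lin_f rho_tilde_linear[OF D] f0(1) by (simp add: linear_on_set_def)
  then have "?r D (f v) = v" if "v \<in> su2" for v
    using linear_eq_on_su2[of "\<lambda>v. ?r D (f v)"] that C h12 Df pauli_su2 by simp
  moreover obtain D' where D': "D' \<in> carrier U2pm" "\<forall>v\<in>su2. ?r D' (?r D v) = v"
    using rho_tilde_inv_apply[OF D] by blast
  ultimately have "?r D' v = f v" if "v \<in> su2" for v
    using D'(2) that f0(1)[OF that] by force
  then have "?r D' = f"
    using f by (intro extensionalityI[OF rho_tilde_extensional]) (auto simp: O3_iff Bij_def)
  with D' show ?thesis by blast
qed

lemma rho_tilde_image: "rho_tilde ` carrier U2pm = carrier O3"
  using rho_tilde_surj rho_tilde_O3 by blast

section \<open>Group structure of \<open>O3\<close> and fibres of \<open>rho_tilde\<close>\<close>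

lemma one_O3: "one O3 = (\<lambda>B\<in>su2. B)"
  by (simp add: O3_def orthogonal_group_def BijGroup_def)

text \<open>A homomorphic image of a group is a group, and by surjectivity the image is all of
  \<open>O3\<close>.\<close>

lemma group_O3: "group O3"
  using group.hom_imp_img_group[OF group_U2pm rho_tilde_hom]
  by (simp add: rho_tilde_image rho_tilde_one flip: one_O3)

text \<open>Multiplying by the inverse of \<open>B\<close> reduces equality of the actions to the
  kernel. Conversely a sign cancels in conjugation, and it does not change a determinant of even
  size.\<close>

lemma rho_tilde_eq_iff:
  assumes "A \<in> carrier U2pm" "B \<in> carrier U2pm"
  shows "rho_tilde A = rho_tilde B \<longleftrightarrow> A = B \<or> A = - B"
proof
  assume eq: "rho_tilde A = rho_tilde B"
  obtain C where C: "C \<in> carrier U2pm" "C ** B = mat 1" "B ** C = mat 1"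
    using group.Units_eq[OF group_U2pm] assms(2) by (force simp: Units_def)
  have CA: "C ** A \<in> carrier U2pm"
    using monoid.m_closed[OF group.is_monoid[OF group_U2pm] C(1) assms(1)] by simp
  have "rho_tilde (C ** A) X = X" if "X \<in> su2" for X
    using that assms C eq
    by (simp add: rho_tilde_mult_apply) (simp add: rho_tilde_one flip: rho_tilde_mult_apply)
  then have "C ** A = mat 1 \<or> C ** A = - mat 1"
    by (rule rho_tilde_kernel[OF CA])
  moreover have "B ** (C ** A) = A" by (simp add: C matrix_mul_assoc)
  moreover have "B ** (- mat 1) = - B" by (simp add: mat2_simps)
  ultimately show "A = B \<or> A = - B" by auto
next
  assume "A = B \<or> A = - B"
  moreover have "- B ** X ** ctranspose (- B) = B ** X ** ctranspose B" "det (- B) = det B" for X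
    by (simp_all add: mat2_simps det_2 algebra_simps)
  ultimately show "rho_tilde A = rho_tilde B"
    using assms uminus_U2pm by (auto simp: rho_tilde_def U2pm_inv)
qed

section \<open>Determinants of the induced automorphisms\<close>

lemma inv_su2_frame:
  assumes "B \<in> su2"
  shows "inv_into UNIV su2_frame B = vector [Im (B$1$2), Re (B$1$2), Im (B$1$1)]"
proof (rule inv_into_f_eq)
  show "inj su2_frame" using su2_frame_bij by (simp add: bij_betw_def)
  show "su2_frame (vector [Im (B$1$2), Re (B$1$2), Im (B$1$1)]) = B"
    using su2_frame_expand[OF assms] by (simp add: su2_frame_def)
qed simp

text \<open>In the real and imaginary parts of \<open>a\<close> and \<open>b\<close> the matrix
  entries are quadratic forms, as in the Euler-Rodrigues formula. The determinant is
  \<open>d\<close> times the cube of the squared norm of the first row, which is one.\<close>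

lemma su2_det_rho_tilde:
  assumes "A \<in> carrier U2pm"
  shows "complex_of_real (su2_det (rho_tilde A)) = det A"
proof -
  obtain a b d where A: "A = mat2 a b (- d * cnj b) (d * cnj a)" "a * cnj a + b * cnj b = 1"
      "d = 1 \<or> d = - 1" "det A = d"
    using U2pmE[OF assms] by metis
  obtain p q r s where ab: "a = Complex p q" "b = Complex r s"
    by (metis complex_surj)
  have n: "p * p + q * q + r * r + s * s = 1"
    using A(2) by (simp add: ab complex_eq_iff)
  \<comment> \<open>Column \<open>j\<close> holds the frame coordinates of the image of the
    \<open>j\<close>-th frame vector. Keeping \<open>C\<close> as a variable lets the rule rewrite
    each entry separately.\<close>
  have m: "matrix (inv_into UNIV su2_frame \<circ> rho_tilde A \<circ> su2_frame) $ i $ j =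
      vector [Im (C$1$2), Re (C$1$2), Im (C$1$1)] $ i"
    if "C = d *\<^sub>C (A ** su2_frame (axis j 1) ** ctranspose A)" for i j C
    using that assms rho_tilde_in_su2[OF assms su2_frame_su2]
    by (simp add: matrix_def inv_su2_frame rho_tilde_apply su2_frame_su2 A(4))
  have frame: "su2_frame (axis 1 1) = \<i> *\<^sub>C e1" "su2_frame (axis 2 1) = \<i> *\<^sub>C e2"
      "su2_frame (axis 3 1) = \<i> *\<^sub>C e3"
    by (simp_all add: su2_frame_def axis_def)
  let ?M = "matrix (inv_into UNIV su2_frame \<circ> rho_tilde A \<circ> su2_frame)"
  from A(3) show ?thesis
  proof
    assume d: "d = 1"
    have "det ?M = (p * p + q * q + r * r + s * s) ^ 3"
      unfolding det_3 m[OF refl] frame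
      by (simp add: A(1) ab d mult2_nth) (simp add: power3_eq_cube algebra_simps)
    then show ?thesis by (simp add: n A(4) d su2_det_def)
  next
    assume d: "d = - 1"
    have "det ?M = - ((p * p + q * q + r * r + s * s) ^ 3)"
      unfolding det_3 m[OF refl] frame
      by (simp add: A(1) ab d mult2_nth) (simp add: power3_eq_cube algebra_simps)
    then show ?thesis by (simp add: n A(4) d su2_det_def)
  qed
qed

section \<open>Exact sequences\<close>

lemma su2_det_hom: "(\<lambda>f. complex_of_real (su2_det f)) \<in> hom O3 sign_group"
proof (rule homI)
  fix f assume "f \<in> carrier O3"
  then obtain A where A: "A \<in> carrier U2pm" "f = rho_tilde A"
    using rho_tilde_surj by blast
  then show "complex_of_real (su2_det f) \<in> carrier sign_group"
    using U2pm_det by (simp add: su2_det_rho_tilde sign_group_def)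
  fix g assume "g \<in> carrier O3"
  then obtain B where B: "B \<in> carrier U2pm" "g = rho_tilde B"
    using rho_tilde_surj by blast
  have "f \<otimes>\<^bsub>O3\<^esub> g = rho_tilde (A ** B)"
    using hom_mult[OF rho_tilde_hom A(1) B(1)] A B by simp
  moreover have "A ** B \<in> carrier U2pm"
    using monoid.m_closed[OF group.is_monoid[OF group_U2pm] A(1) B(1)] by simp
  ultimately show "complex_of_real (su2_det (f \<otimes>\<^bsub>O3\<^esub> g)) =
      complex_of_real (su2_det f) \<otimes>\<^bsub>sign_group\<^esub> complex_of_real (su2_det g)"
    using A B by (simp add: su2_det_rho_tilde sign_group_def det_mul)
qed

lemma sign_surj: "det ` carrier U2pm = carrier sign_group"
proof -
  have "mat 1 \<in> carrier U2pm" using pm_id_subset by (auto simp: SU2_def)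
  from imageI[OF this, of det] have "1 \<in> det ` carrier U2pm" by simp
  moreover have "\<i> *\<^sub>C e1 \<noteq> 0" by (simp add: cmat2_eq_iff)
  \<comment> \<open>Any reflection element attains the sign \<open>- 1\<close>; the one along the
    first basis vector is taken.\<close>
  note r = reflection_elt[OF pauli_su2(1) this]
  from imageI[OF r(1), of det] have "- 1 \<in> det ` carrier U2pm" by (simp add: r(2))
  ultimately have "{1, - 1} \<subseteq> det ` carrier U2pm" by simp
  then show ?thesis
    using U2pm_det by (auto simp: sign_group_def)
qed

lemma SU2_U2pm: "A \<in> carrier SU2 \<longleftrightarrow> A \<in> carrier U2pm \<and> det A = 1"
  by (simp add: SU2_def)

lemma SO3_O3: "f \<in> carrier SO3 \<longleftrightarrow> f \<in> carrier O3 \<and> su2_det f = 1"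
  by (simp add: SO3_def)

lemma mult_SU2: "mult SU2 = mult U2pm" "one SU2 = one U2pm"
  by (simp_all add: SU2_def)

lemma mult_SO3: "mult SO3 = mult O3" "one SO3 = one O3"
  by (simp_all add: SO3_def)

lemma subgroup_SO3: "subgroup (carrier SO3) O3"
proof -
  interpret group_hom O3 sign_group "\<lambda>f. complex_of_real (su2_det f)"
    by (simp add: group_hom_def group_hom_axioms_def group_O3 group_sign su2_det_hom)
  have "carrier SO3 = kernel O3 sign_group (\<lambda>f. complex_of_real (su2_det f))"
    by (auto simp: SO3_O3 kernel_def sign_group_def)
  then show ?thesis using subgroup_kernel by simp
qed

lemma group_SO3: "group SO3"
  using group.subgroup_imp_group[OF group_O3 subgroup_SO3] by (simp add: SO3_def)

text \<open>Since \<open>rho_tilde\<close> transports \<open>det\<close> to \<open>su2_det\<close>,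
  the preimage of \<open>SO3\<close> in \<open>U2pm\<close> is precisely \<open>SU2\<close>.\<close>

lemma rho_image: "rho ` carrier SU2 = carrier SO3"
proof -
  have "f \<in> carrier SO3 \<longleftrightarrow> f \<in> rho_tilde ` carrier SU2" for f
  proof -
    have "su2_det (rho_tilde A) = 1 \<longleftrightarrow> det A = 1" if "A \<in> carrier U2pm" for A
      using su2_det_rho_tilde[OF that] of_real_eq_1_iff[of "su2_det (rho_tilde A)", where 'a = complex]
      by simp
    then show ?thesis
      unfolding SO3_O3 rho_tilde_image[symmetric] by (auto simp: SU2_U2pm)
  qed
  then show ?thesis by (auto simp: rho_def)
qed

lemma rho_hom: "rho \<in> hom SU2 SO3"
proof (rule homI)
  fix A B assume AB: "A \<in> carrier SU2" "B \<in> carrier SU2"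
  show "rho A \<in> carrier SO3" using AB rho_image by blast
  have "A ** B \<in> carrier SU2"
    using monoid.m_closed[OF group.is_monoid[OF group_SU2] AB] by (simp add: mult_SU2)
  then show "rho (A \<otimes>\<^bsub>SU2\<^esub> B) = rho A \<otimes>\<^bsub>SO3\<^esub> rho B"
    using AB hom_mult[OF rho_tilde_hom, of A B] by (simp add: rho_def mult_SU2 mult_SO3 SU2_U2pm)
qed

lemma kernel_rho_tilde: "kernel U2pm O3 rho_tilde = {mat 1, - mat 1}"
proof -
  have 1: "mat 1 \<in> carrier U2pm" "- mat 1 \<in> carrier U2pm"
    using pm_id_subset by (auto simp: SU2_def)
  have "one O3 = rho_tilde (mat 1)" by (simp add: one_O3 rho_tilde_one)
  with 1 show ?thesis
    by (auto simp: kernel_def rho_tilde_eq_iff)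
qed

lemma kernel_rho: "kernel SU2 SO3 rho = {mat 1, - mat 1}"
proof -
  have "kernel SU2 SO3 rho = carrier SU2 \<inter> kernel U2pm O3 rho_tilde"
    by (auto simp: kernel_def rho_def SU2_U2pm mult_SO3)
  then show ?thesis using pm_id_subset kernel_rho_tilde by auto
qed

lemma group_hom_id:
  assumes "group G" "group H" "carrier G \<subseteq> carrier H" "mult G = mult H"
  shows "group_hom G H id"
  using assms by (auto simp: group_hom_def group_hom_axioms_def hom_def)

lemma kernel_id: "one G = one H \<Longrightarrow> one G \<in> carrier G \<Longrightarrow> kernel G H id = {\<one>\<^bsub>G\<^esub>}"
  by (auto simp: kernel_def)

lemma group_one_in: "group G \<Longrightarrow> one G \<in> carrier G"
  using monoid.one_closed group.is_monoid by blast

lemma pm_id_simps: "carrier pm_id_group = {mat 1, - mat 1}" "mult pm_id_group = mult U2pm"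
    "one pm_id_group = one U2pm"
  by (simp_all add: pm_id_group_def)

text \<open>All four sequences start with an inclusion, so injectivity on the left is automatic and
  only the kernel and image of \<open>g\<close> remain to be computed.\<close>

lemma short_exact_subI:
  assumes "group K" "group_hom G H g" "carrier K \<subseteq> carrier G" "mult K = mult G" "one K = one G"
    and "carrier K = kernel G H g" "g ` carrier G = carrier H"
  shows "short_exact K G H id g"
  using assms group_hom_id[of K G] kernel_id[of K G] group_one_in[of K]
  by (simp add: short_exact_def group_hom_def)

lemma short_exact_det: "short_exact SU2 U2pm sign_group id det"
proof (rule short_exact_subI)
  show "carrier SU2 = kernel U2pm sign_group det"
    by (auto simp: SU2_U2pm kernel_def sign_group_def)
qed (auto simp: group_SU2 group_hom_def group_hom_axioms_def group_U2pm group_sign det_hom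
    SU2_U2pm mult_SU2 sign_surj)

lemma short_exact_su2_det:
  "short_exact SO3 O3 sign_group id (\<lambda>f. complex_of_real (su2_det f))"
proof (rule short_exact_subI)
  show "carrier SO3 = kernel O3 sign_group (\<lambda>f. complex_of_real (su2_det f))"
    by (auto simp: SO3_O3 kernel_def sign_group_def)
  show "(\<lambda>f. complex_of_real (su2_det f)) ` carrier O3 = carrier sign_group"
    unfolding rho_tilde_image[symmetric] sign_surj[symmetric] image_image
    by (rule image_cong) (simp_all add: su2_det_rho_tilde)
qed (auto simp: group_SO3 group_hom_def group_hom_axioms_def group_O3 group_sign
    su2_det_hom SO3_O3 mult_SO3)

lemma short_exact_rho: "short_exact pm_id_group SU2 SO3 id rho"
  by (rule short_exact_subI)
     (use pm_id_subset in \<open>auto simp: group_pm_id group_hom_def group_hom_axioms_def group_SU2 group_SO3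
      rho_hom pm_id_simps mult_SU2 kernel_rho rho_image\<close>)

lemma short_exact_rho_tilde: "short_exact pm_id_group U2pm O3 id rho_tilde"
  by (rule short_exact_subI)
     (use pm_id_subset in \<open>auto simp: group_pm_id group_hom_def group_hom_axioms_def group_U2pm group_O3
      rho_tilde_hom pm_id_simps kernel_rho_tilde rho_tilde_image SU2_U2pm\<close>)

section \<open>The coverings\<close>

text \<open>In the topology of pointwise convergence it suffices to fix \<open>B\<close>. The value
  is polynomial in the entries of \<open>A\<close> and their conjugates for \<open>B\<close> in
  \<open>su2\<close>, and the constant \<open>undefined\<close> elsewhere.\<close>

lemma continuous_on_rho_tilde: "continuous_on (carrier U2pm) rho_tilde"
proof (rule continuous_on_coordinatewise_then_product)
  fix B
  show "continuous_on (carrier U2pm) (\<lambda>A. rho_tilde A B)"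
  proof (cases "B \<in> su2")
    case True
    have "continuous_on (carrier U2pm) (\<lambda>A. det A *\<^sub>C (A ** B ** ctranspose A))"
      by (rule continuous_on_cmat2I) (auto simp: mult2_nth det_2 intro!: continuous_intros)
    then show ?thesis
      by (rule continuous_on_eq) (simp add: True rho_tilde_apply)
  next
    case False
    then have "rho_tilde A B = undefined" for A by (simp add: rho_tilde_def)
    then show ?thesis by simp
  qed
qed

lemma Hausdorff_space_fun_subset:
  "Hausdorff_space (top_of_set (T :: ('a \<Rightarrow> 'b::t2_space) set))"
  by (rule Hausdorff_space_subtopology) (rule Hausdorff_space_euclidean_fun)

lemma zero_notin_U2pm: "0 \<notin> carrier U2pm"
  by (auto dest: U2pm_det simp: det_2)

lemma group_covering_rho_tilde: "group_covering U2pm rho_tilde O3"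
  unfolding group_covering_def
proof
  show "group_hom U2pm O3 rho_tilde"
    by (simp add: group_hom_def group_hom_axioms_def group_U2pm group_O3 rho_tilde_hom)
  show "covering_space (carrier U2pm) rho_tilde (carrier O3)"
    by (rule covering_space_antipodal)
       (auto simp: compact_U2pm zero_notin_U2pm Hausdorff_space_fun_subset continuous_on_rho_tilde
         rho_tilde_image uminus_U2pm rho_tilde_eq_iff)
qed

lemma group_covering_rho: "group_covering SU2 rho SO3"
  unfolding group_covering_def
proof
  show "group_hom SU2 SO3 rho"
    by (simp add: group_hom_def group_hom_axioms_def group_SU2 group_SO3 rho_hom)
  have eq: "rho A = rho_tilde A" if "A \<in> carrier SU2" for A
    using that by (simp add: rho_def)
  show "covering_space (carrier SU2) rho (carrier SO3)"
  proof (rule covering_space_antipodal)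
    show "continuous_on (carrier SU2) rho"
      using continuous_on_subset[OF continuous_on_rho_tilde, of "carrier SU2"]
      by (rule continuous_on_eq) (auto simp: SU2_U2pm eq)
    show "uminus ` carrier SU2 \<subseteq> carrier SU2"
      by (auto simp: SU2_U2pm uminus_U2pm det_2)
    show "rho A = rho B \<longleftrightarrow> A = B \<or> A = - B" if "A \<in> carrier SU2" "B \<in> carrier SU2" for A B
      using that by (simp add: eq SU2_U2pm rho_tilde_eq_iff)
  qed (use zero_notin_U2pm in \<open>auto simp: compact_SU2 Hausdorff_space_fun_subset rho_image SU2_U2pm\<close>)
qed

section \<open>The Pin group\<close>

text \<open>The sign \<open>s\<close> is the parity of \<open>x\<close>: the automorphism
  \<open>alpha_expl\<close> multiplies \<open>x\<close> by \<open>1\<close> on the even part and by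
  \<open>- 1\<close> on the odd part.\<close>

lemma Cl_homD:
  assumes "x \<in> carrier Cl_hom"
  obtains s where "s = 1 \<or> s = - 1" "x$2$2 = s * cnj (x$1$1)" "x$2$1 = - s * cnj (x$1$2)"
proof -
  have "alpha_expl x = x \<or> alpha_expl x = - x"
    using assms by (auto simp: Cl_hom_def Cl0_eq Cl1_eq)
  then show ?thesis
  proof
    assume a: "alpha_expl x = x"
    have "alpha_expl x $ 2 $ 2 = x $ 2 $ 2" "alpha_expl x $ 2 $ 1 = x $ 2 $ 1"
      by (simp_all only: a)
    then show ?thesis
      by (intro that[of 1]) (simp_all add: alpha_expl_def)
  next
    assume a: "alpha_expl x = - x"
    have "alpha_expl x $ 2 $ 2 = (- x) $ 2 $ 2" "alpha_expl x $ 2 $ 1 = (- x) $ 2 $ 1"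
      by (simp_all only: a)
    then show ?thesis
      by (intro that[of "- 1"]) (simp_all add: alpha_expl_def)
  qed
qed

text \<open>The anti-automorphism is the adjugate of a 2 by 2 matrix, so
  \<open>Cl_bar x ** x\<close> is \<open>det x\<close> times the identity.\<close>

lemma Cl_norm_eq:
  assumes "x \<in> carrier Cl_hom"
  shows "complex_of_real (Cl_norm x) = det x"
proof -
  have "Cl_bar x ** x = Cl_norm x *\<^sub>R mat 1"
    unfolding Cl_norm_def by (rule theI'[OF ex1_Cl_norm[OF assms]])
  moreover have "Cl_bar x ** x = det x *\<^sub>C mat 1"
    by (simp add: Cl_bar_eq bar_expl_def mat2_simps det_2 algebra_simps)
  ultimately have "det x *\<^sub>C mat 1 = Cl_norm x *\<^sub>R (mat 1 :: cmat2)"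
    by simp
  then have "(det x *\<^sub>C mat 1) $ 1 $ 1 = (Cl_norm x *\<^sub>R (mat 1 :: cmat2)) $ 1 $ 1"
    by (simp only:)
  then show ?thesis
    by (simp add: mat_nth scaleR_conv_of_real[where 'a = complex])
qed

lemma PIN3_subset_U2pm:
  assumes "x \<in> carrier Cl_hom" "(Cl_norm x)\<^sup>2 = 1"
  shows "x \<in> carrier U2pm"
proof -
  have det: "det x = 1 \<or> det x = - 1"
    using assms(2) by (auto simp: power2_eq_1_iff simp flip: Cl_norm_eq[OF assms(1)])
  obtain s where s: "s = 1 \<or> s = - 1" "x$2$2 = s * cnj (x$1$1)" "x$2$1 = - s * cnj (x$1$2)"
    by (rule Cl_homD[OF assms(1)])
  \<comment> \<open>The determinant is parity times the squared norm \<open>n\<close> of the first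
    row. As \<open>n\<close> is nonnegative, a determinant of \<open>1\<close> or \<open>- 1\<close>
    forces \<open>n = 1\<close>, so the parity is the determinant.\<close>
  define n where "n = x$1$1 * cnj (x$1$1) + x$1$2 * cnj (x$1$2)"
  have "det x = s * n"
    using s by (simp add: det_2 n_def algebra_simps)
  with det s(1) have "n = 1 \<or> - n = 1" by auto
  moreover have "Re n \<ge> 0" by (simp add: n_def)
  then have "- n \<noteq> 1" by (auto simp: complex_eq_iff)
  ultimately have "n = 1" by blast
  moreover have "x = mat2 (x$1$1) (x$1$2) (- s * cnj (x$1$2)) (s * cnj (x$1$1))"
    unfolding cmat2_eq_iff mat2_nth using s(2,3) by simp
  ultimately show ?thesis
    unfolding U2pm_iff using s(1)
    by (intro exI[of _ "x$1$1"] exI[of _ "x$1$2"] exI[of _ s] conjI) (simp_all add: n_def)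
qed

lemma U2pm_subset_PIN3:
  assumes "x \<in> carrier U2pm"
  shows "x \<in> carrier Cl_hom" "(Cl_norm x)\<^sup>2 = 1"
proof -
  obtain a b d where x: "x = mat2 a b (- d * cnj b) (d * cnj a)"
      "a * cnj a + b * cnj b = 1" "d = 1 \<or> d = - 1" "det x = d"
    by (rule U2pmE[OF assms])
  from x(1,3) have "alpha_expl x = x \<or> alpha_expl x = - x"
    by (auto simp: alpha_expl_def mat2_simps)
  moreover have "invertible x"
    using x(3,4) by (auto simp: invertible_cmat2)
  ultimately show *: "x \<in> carrier Cl_hom"
    by (auto simp: Cl_hom_def Cl0_eq Cl1_eq)
  have "(complex_of_real (Cl_norm x))\<^sup>2 = 1"
    using x(3,4) by (auto simp: Cl_norm_eq[OF *])
  then show "(Cl_norm x)\<^sup>2 = 1"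
    by (simp flip: of_real_power)
qed

lemma PIN3_eq_U2pm: "PIN3 = U2pm"
proof -
  have "carrier PIN3 = carrier U2pm"
    using PIN3_subset_U2pm U2pm_subset_PIN3
    by (auto simp: PIN3_def kernel_def Rstar_def)
  moreover have "PIN3 = U2pm\<lparr>carrier := carrier PIN3\<rparr>"
    by (simp add: PIN3_def U2pm_def Cl_hom_def)
  ultimately show ?thesis by simp
qed

lemma alpha_U2pm: "A \<in> carrier U2pm \<Longrightarrow> Cl_alpha A = det A *\<^sub>C A"
  by (erule U2pmE) (auto simp: Cl_alpha_eq alpha_expl_def mat2_simps)

section \<open>Passage between \<open>E3\<close> and \<open>su2\<close>\<close>

text \<open>The inverse of \<open>E3_to_su2\<close> on the orthogonal groups. It exhibits the Pin
  covering as \<open>rho_tilde\<close> followed by a transport.\<close>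

definition su2_to_E3 :: "(cmat2 \<Rightarrow> cmat2) \<Rightarrow> cmat2 \<Rightarrow> cmat2" where
  "su2_to_E3 f = (\<lambda>v\<in>E3. (- \<i>) *\<^sub>C f (\<i> *\<^sub>C v))"

lemma ii_cancel [simp]: "(- \<i>) *\<^sub>C \<i> *\<^sub>C v = v" "\<i> *\<^sub>C (- \<i>) *\<^sub>C v = v"
  by (simp_all add: cscale_cscale)

lemma E3_to_su2_mem:
  "v \<in> E3 \<Longrightarrow> \<i> *\<^sub>C v \<in> su2" "B \<in> su2 \<Longrightarrow> (- \<i>) *\<^sub>C B \<in> E3"
proof -
  show "\<i> *\<^sub>C v \<in> su2" if "v \<in> E3" using that E3_to_su2_bij by (auto simp: bij_betw_def)
  show "(- \<i>) *\<^sub>C B \<in> E3" if "B \<in> su2"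
  proof -
    have "B \<in> (*\<^sub>C) \<i> ` E3" using that E3_to_su2_bij by (simp add: bij_betw_def)
    then show ?thesis by auto
  qed
qed

text \<open>By Cayley-Hamilton a traceless \<open>v\<close> squares to \<open>- det v\<close>, which
  is \<open>det (\<i> *\<^sub>C v)\<close>. Hence multiplication by \<open>\<i>\<close> matches the
  Clifford form on \<open>E3\<close> with \<open>det\<close> on \<open>su2\<close>.\<close>

lemma E3_square:
  assumes "v \<in> E3"
  shows "v ** v = det (\<i> *\<^sub>C v) *\<^sub>C mat 1"
proof -
  have "v$2$2 = - v$1$1"
    using E3_to_su2_mem(1)[OF assms] by (simp add: su2_iff complex_eq_iff)
  then show ?thesis
    by (simp add: mat2_simps det_cscale) (simp add: det_2 algebra_simps)
qed

lemma O_E3_iff: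
  "f \<in> carrier O_E3 \<longleftrightarrow> f \<in> Bij E3 \<and> linear_on_set scaleR scaleR E3 f \<and> (\<forall>v\<in>E3. f v ** f v = v ** v)"
  by (simp add: O_E3_def orthogonal_group_def)

lemma cscale_add: "c *\<^sub>C (x + y) = c *\<^sub>C x + c *\<^sub>C y" "c *\<^sub>C (r *\<^sub>R x) = r *\<^sub>R c *\<^sub>C x"
  by (simp_all add: mat2_simps algebra_simps)

lemma cscale_one_eq: "c *\<^sub>C mat 1 = d *\<^sub>C mat 1 \<longleftrightarrow> c = d"
  by (auto simp: mat2_simps)

lemma bij_betw_conjugate:
  assumes f: "bij_betw f S S" and h: "\<And>x. x \<in> T \<Longrightarrow> h x \<in> S" "\<And>y. y \<in> S \<Longrightarrow> k y \<in> T"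
    and hk: "\<And>x. x \<in> T \<Longrightarrow> k (h x) = x" "\<And>y. y \<in> S \<Longrightarrow> h (k y) = y"
  shows "bij_betw (\<lambda>x. k (f (h x))) T T"
proof -
  have "bij_betw h T S" "bij_betw k S T"
    using h hk by (auto intro!: bij_betwI)
  from bij_betw_trans[OF bij_betw_trans[OF this(1) f] this(2)] show ?thesis
    by (simp add: o_def)
qed

lemma E3_to_su2_O3:
  assumes f: "f \<in> carrier O_E3"
  shows "E3_to_su2 f \<in> carrier O3"
proof -
  have bij: "bij_betw f E3 E3" and lin: "linear_on_set scaleR scaleR E3 f"
    and q: "\<And>v. v \<in> E3 \<Longrightarrow> f v ** f v = v ** v"
    using f by (auto simp: O_E3_iff Bij_def)
  have mem: "f v \<in> E3" if "v \<in> E3" for v using bij that by (auto simp: bij_betw_def)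
  have "bij_betw (\<lambda>B. \<i> *\<^sub>C f ((- \<i>) *\<^sub>C B)) su2 su2"
    by (rule bij_betw_conjugate[OF bij]) (use E3_to_su2_mem in auto)
  then have "E3_to_su2 f \<in> Bij su2"
    by (simp add: Bij_def E3_to_su2_def cong: bij_betw_cong)
  moreover have "linear_on_set scaleR scaleR su2 (E3_to_su2 f)"
    using lin E3_to_su2_mem(2) subspace_su2
    by (simp add: linear_on_set_def E3_to_su2_def subspace_add subspace_scale cscale_add)
  moreover have "det (E3_to_su2 f B) = det B" if "B \<in> su2" for B
  proof -
    define v where "v = (- \<i>) *\<^sub>C B"
    have v: "v \<in> E3" "B = \<i> *\<^sub>C v" using that E3_to_su2_mem by (auto simp: v_def)
    then show ?thesis
      using q[OF v(1)] E3_square[OF v(1)] E3_square[OF mem[OF v(1)]] that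
      by (simp add: E3_to_su2_def cscale_one_eq)
  qed
  ultimately show ?thesis by (simp add: O3_iff)
qed

lemma su2_to_E3_O_E3:
  assumes f: "f \<in> carrier O3"
  shows "su2_to_E3 f \<in> carrier O_E3"
proof -
  have bij: "bij_betw f su2 su2" and lin: "linear_on_set scaleR scaleR su2 f"
    and q: "\<And>v. v \<in> su2 \<Longrightarrow> det (f v) = det v"
    using f by (auto simp: O3_iff Bij_def)
  have mem: "f v \<in> su2" if "v \<in> su2" for v using bij that by (auto simp: bij_betw_def)
  have sub: "subspace E3" by (simp add: E3_def)
  have "bij_betw (\<lambda>v. (- \<i>) *\<^sub>C f (\<i> *\<^sub>C v)) E3 E3"
    by (rule bij_betw_conjugate[OF bij]) (use E3_to_su2_mem in auto)
  then have 1: "su2_to_E3 f \<in> Bij E3"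
    by (simp add: Bij_def su2_to_E3_def cong: bij_betw_cong)
  moreover have "linear_on_set scaleR scaleR E3 (su2_to_E3 f)"
    using lin E3_to_su2_mem(1) sub
    by (simp add: linear_on_set_def su2_to_E3_def subspace_add subspace_scale cscale_add)
  moreover have "su2_to_E3 f v ** su2_to_E3 f v = v ** v" if "v \<in> E3" for v
  proof -
    have "su2_to_E3 f v \<in> E3" using 1 that by (auto simp: Bij_def bij_betw_def)
    moreover have "\<i> *\<^sub>C su2_to_E3 f v = f (\<i> *\<^sub>C v)" using that by (simp add: su2_to_E3_def)
    ultimately show ?thesis
      using that E3_to_su2_mem(1)[OF that] by (simp add: E3_square q)
  qed
  ultimately show ?thesis by (simp add: O_E3_iff)
qed

lemma E3_to_su2_inverse:
  "f \<in> carrier O_E3 \<Longrightarrow> su2_to_E3 (E3_to_su2 f) = f"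
  "g \<in> carrier O3 \<Longrightarrow> E3_to_su2 (su2_to_E3 g) = g"
proof -
  show "su2_to_E3 (E3_to_su2 f) = f" if f: "f \<in> carrier O_E3"
  proof (rule extensionalityI[of _ E3])
    show "f \<in> extensional E3" using f by (simp add: O_E3_iff Bij_def)
  qed (simp_all add: su2_to_E3_def E3_to_su2_def E3_to_su2_mem)
  show "E3_to_su2 (su2_to_E3 g) = g" if g: "g \<in> carrier O3"
  proof (rule extensionalityI[of _ su2])
    show "g \<in> extensional su2" using g by (simp add: O3_iff Bij_def)
  qed (simp_all add: su2_to_E3_def E3_to_su2_def E3_to_su2_mem)
qed

text \<open>This direction comes first because it starts from the known group \<open>O3\<close>,
  making \<open>O_E3\<close> a group as its image. The homomorphism property of
  \<open>E3_to_su2\<close> then follows by inversion.\<close>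

lemma su2_to_E3_hom: "su2_to_E3 \<in> hom O3 O_E3"
proof (rule homI)
  fix f g assume fg: "f \<in> carrier O3" "g \<in> carrier O3"
  have "su2_to_E3 (compose su2 f g) = compose E3 (su2_to_E3 f) (su2_to_E3 g)"
    by (rule extensionalityI[of _ E3])
       (simp_all add: su2_to_E3_def compose_def E3_to_su2_mem O3_in_su2[OF fg(2)])
  then show "su2_to_E3 (f \<otimes>\<^bsub>O3\<^esub> g) = su2_to_E3 f \<otimes>\<^bsub>O_E3\<^esub> su2_to_E3 g"
    using fg su2_to_E3_O_E3[OF fg(1)] su2_to_E3_O_E3[OF fg(2)]
    by (simp add: O_E3_iff O3_iff) (simp add: O_E3_def O3_def orthogonal_group_def BijGroup_def)
qed (rule su2_to_E3_O_E3)

lemma su2_to_E3_image: "su2_to_E3 ` carrier O3 = carrier O_E3"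
  by (rule bij_betw_imp_surj_on, rule bij_betwI[where g = E3_to_su2])
     (auto simp: E3_to_su2_O3 su2_to_E3_O_E3 E3_to_su2_inverse)

lemma group_O_E3: "group O_E3"
proof -
  have "su2_to_E3 (one O3) = one O_E3"
    by (rule extensionalityI[of _ E3])
       (simp_all add: one_O3 su2_to_E3_def E3_to_su2_mem O_E3_def orthogonal_group_def BijGroup_def)
  then show ?thesis
    using group.hom_imp_img_group[OF group_O3 su2_to_E3_hom] by (simp add: su2_to_E3_image)
qed

lemma E3_to_su2_iso: "E3_to_su2 \<in> iso O_E3 O3"
  unfolding iso_def
proof (intro CollectI conjI)
  show "bij_betw E3_to_su2 (carrier O_E3) (carrier O3)"
    by (rule bij_betwI[where g = su2_to_E3])
       (auto simp: E3_to_su2_O3 su2_to_E3_O_E3 E3_to_su2_inverse)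
  show "E3_to_su2 \<in> hom O_E3 O3"
  proof (rule homI)
    fix f g assume fg: "f \<in> carrier O_E3" "g \<in> carrier O_E3"
    define F G where "F = E3_to_su2 f" "G = E3_to_su2 g"
    have FG: "F \<in> carrier O3" "G \<in> carrier O3" "f = su2_to_E3 F" "g = su2_to_E3 G"
      using fg by (simp_all add: F_G_def E3_to_su2_O3 E3_to_su2_inverse)
    then have "F \<otimes>\<^bsub>O3\<^esub> G \<in> carrier O3"
      using monoid.m_closed[OF group.is_monoid[OF group_O3]] by blast
    then show "E3_to_su2 (f \<otimes>\<^bsub>O_E3\<^esub> g) = E3_to_su2 f \<otimes>\<^bsub>O3\<^esub> E3_to_su2 g"
      using FG by (simp add: E3_to_su2_inverse flip: hom_mult[OF su2_to_E3_hom])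
  qed (rule E3_to_su2_O3)
qed

lemma continuous_on_cscale: "continuous_on S f \<Longrightarrow> continuous_on S (\<lambda>x. c *\<^sub>C f x)"
  by (rule continuous_on_cmat2I) (auto intro!: continuous_intros)

lemma E3_to_su2_homeomorphism:
  "homeomorphism (carrier O_E3) (carrier O3) E3_to_su2 su2_to_E3"
proof (rule homeomorphismI)
  have eval: "continuous_on S (\<lambda>f. f x)" for S :: "(cmat2 \<Rightarrow> cmat2) set" and x
    by (rule continuous_on_subset[OF continuous_on_product_coordinates subset_UNIV])
  show "continuous_on (carrier O_E3) E3_to_su2"
  proof (rule continuous_on_coordinatewise_then_product)
    show "continuous_on (carrier O_E3) (\<lambda>f. E3_to_su2 f B)" for B
      by (cases "B \<in> su2") (auto simp: E3_to_su2_def intro!: continuous_on_cscale eval)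
  qed
  show "continuous_on (carrier O3) su2_to_E3"
  proof (rule continuous_on_coordinatewise_then_product)
    show "continuous_on (carrier O3) (\<lambda>f. su2_to_E3 f v)" for v
      by (cases "v \<in> E3") (auto simp: su2_to_E3_def intro!: continuous_on_cscale eval)
  qed
qed (auto simp: E3_to_su2_O3 su2_to_E3_O_E3 E3_to_su2_inverse)

section \<open>The canonical covering by the Pin group\<close>

text \<open>On \<open>U2pm\<close> the twist by \<open>Cl_alpha\<close> contributes exactly the
  factor \<open>det A\<close>, and the central scalars \<open>\<i>\<close> and \<open>- \<i>\<close>
  cancel.\<close>

lemma pin_covering_eq:
  assumes "A \<in> carrier U2pm"
  shows "pin_covering A = su2_to_E3 (rho_tilde A)"
proof (rule extensionalityI[of _ E3])
  have "- (\<i> * (c * \<i>)) = c" for c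
    by (simp add: complex_eq_iff)
  then show "pin_covering A v = su2_to_E3 (rho_tilde A) v" if "v \<in> E3" for v
    using assms that by (simp add: pin_covering_def su2_to_E3_def rho_tilde_def E3_to_su2_mem alpha_U2pm
       cscale_mult cscale_cscale)
qed (simp_all add: pin_covering_def su2_to_E3_def)

lemma pin_covering_hom: "pin_covering \<in> hom U2pm O_E3"
proof (rule homI)
  fix A B assume AB: "A \<in> carrier U2pm" "B \<in> carrier U2pm"
  show "pin_covering A \<in> carrier O_E3"
    using AB by (simp add: pin_covering_eq su2_to_E3_O_E3 rho_tilde_O3)
  have "A \<otimes>\<^bsub>U2pm\<^esub> B \<in> carrier U2pm"
    using AB by (rule monoid.m_closed[OF group.is_monoid[OF group_U2pm]])
  from pin_covering_eq[OF this]
  show "pin_covering (A \<otimes>\<^bsub>U2pm\<^esub> B) = pin_covering A \<otimes>\<^bsub>O_E3\<^esub> pin_covering B"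
    unfolding pin_covering_eq[OF AB(1)] pin_covering_eq[OF AB(2)] hom_mult[OF rho_tilde_hom AB]
      hom_mult[OF su2_to_E3_hom rho_tilde_O3[OF AB(1)] rho_tilde_O3[OF AB(2)]] .
qed

lemma group_covering_pin: "group_covering U2pm pin_covering O_E3"
  unfolding group_covering_def
proof
  show "group_hom U2pm O_E3 pin_covering"
    by (simp add: group_hom_def group_hom_axioms_def group_U2pm group_O_E3 pin_covering_hom)
  show "covering_space (carrier U2pm) pin_covering (carrier O_E3)"
  proof (rule covering_space_antipodal)
    have "continuous_on (rho_tilde ` carrier U2pm) su2_to_E3"
      using E3_to_su2_homeomorphism by (simp add: homeomorphism_def rho_tilde_image)
    from continuous_on_compose[OF continuous_on_rho_tilde this]
    show "continuous_on (carrier U2pm) pin_covering"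
      by (rule continuous_on_eq) (simp add: pin_covering_eq)
    have "pin_covering ` carrier U2pm = su2_to_E3 ` rho_tilde ` carrier U2pm"
      unfolding image_image by (rule image_cong) (simp_all add: pin_covering_eq)
    then show "pin_covering ` carrier U2pm = carrier O_E3"
      by (simp add: rho_tilde_image su2_to_E3_image)
    show "pin_covering A = pin_covering B \<longleftrightarrow> A = B \<or> A = - B"
      if AB: "A \<in> carrier U2pm" "B \<in> carrier U2pm" for A B
    proof -
      have "pin_covering A = pin_covering B \<longleftrightarrow> rho_tilde A = rho_tilde B"
        unfolding pin_covering_eq[OF AB(1)] pin_covering_eq[OF AB(2)]
        by (rule inj_on_eq_iff[OF inj_on_inverseI[where g = E3_to_su2 and A = "carrier O3"]])
           (use AB in \<open>simp_all add: E3_to_su2_inverse rho_tilde_O3\<close>)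
      then show ?thesis using AB by (simp add: rho_tilde_eq_iff)
    qed
  qed (auto simp: compact_U2pm zero_notin_U2pm Hausdorff_space_fun_subset uminus_U2pm)
qed

lemma identifies_pin_covering:
  "identifies_coverings id E3_to_su2 PIN3 pin_covering O_E3 U2pm rho_tilde O3"
proof -
  have "top_group_iso U2pm U2pm id"
    unfolding top_group_iso_def
  proof
    show "id \<in> iso U2pm U2pm" by (simp add: iso_def hom_def)
    have "homeomorphism (carrier U2pm) (carrier U2pm) id id"
      by (simp add: homeomorphism_def)
    then show "\<exists>\<psi>. homeomorphism (carrier U2pm) (carrier U2pm) id \<psi>" by blast
  qed
  moreover have "top_group_iso O_E3 O3 E3_to_su2"
    unfolding top_group_iso_def using E3_to_su2_iso E3_to_su2_homeomorphism by blast
  moreover have "rho_tilde (id A) = E3_to_su2 (pin_covering A)" if "A \<in> carrier U2pm" for A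
    using that by (simp add: pin_covering_eq E3_to_su2_inverse rho_tilde_O3)
  ultimately show ?thesis
    by (simp add: identifies_coverings_def PIN3_eq_U2pm group_covering_pin group_covering_rho_tilde)
qed

section \<open>Reflections\<close>

text \<open>A reflection is \<open>1 - 2 P\<close> with \<open>P\<close> a rank one projection, and
  the trace and determinant follow from \<open>l a = 1\<close>. Conversely the two conditions give
  \<open>(1 - x) / 2\<close> trace one and determinant zero, so it factors as a column times a
  row.\<close>

lemma is_reflection_cmat2_iff:
  "is_reflection (*s) (UNIV :: (complex^2) set) ((*v) x) \<longleftrightarrow> trace x = 0 \<and> det x = - 1"
proof
  assume "is_reflection (*s) (UNIV :: (complex^2) set) ((*v) x)"
  then obtain l :: "complex^2 \<Rightarrow> complex" and a where
      l: "linear_on_set (*s) (*) UNIV l" "l a = 1" and x: "\<And>v. x *v v = v - (2 * l v) *s a"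
    by (auto simp: is_reflection_def)
  define p q where "p = l (axis 1 1)" "q = l (axis 2 1)"
  have a: "a$1 *s axis 1 1 + a$2 *s axis 2 1 = a"
    by (simp add: vec_eq_iff forall_2 axis_def)
  have "l (a$1 *s axis 1 1 + a$2 *s axis 2 1) = a$1 * p + a$2 * q"
    using l(1) by (simp add: linear_on_set_def p_q_def)
  then have pq: "a$1 * p + a$2 * q = 1" using l(2) unfolding a by simp
  have col: "x $ i $ j = (axis j 1 - (2 * l (axis j 1)) *s a) $ i" for i j
    unfolding x[symmetric] by (simp add: matrix_vector_mult_def axis_def if_distrib cong: if_cong)
  have "x$1$1 = 1 - 2 * p * a$1" "x$1$2 = - 2 * q * a$1" "x$2$1 = - 2 * p * a$2" "x$2$2 = 1 - 2 * q * a$2"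
    unfolding col p_q_def by (simp_all add: axis_def)
  then have "trace x = 2 - 2 * (a$1 * p + a$2 * q)" "det x = 1 - 2 * (a$1 * p + a$2 * q)"
    by (simp_all only: trace_def sum_2 det_2) (simp_all add: algebra_simps)
  then show "trace x = 0 \<and> det x = - 1" by (simp add: pq)
next
  assume x: "trace x = 0 \<and> det x = - 1"
  \<comment> \<open>These are entries of \<open>(1 - x) / 2\<close>, whose remaining diagonal entry
    is \<open>1 - p\<close>. Its vanishing determinant is the relation \<open>pqr\<close>
    below.\<close>
  define p q r where "p = (1 - x$1$1) / 2" "q = - x$1$2 / 2" "r = - x$2$1 / 2"
  have xe: "x$1$1 = 1 - 2 * p" "x$1$2 = - 2 * q" "x$2$1 = - 2 * r"
    by (simp_all add: p_q_r_def field_simps)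
  have x22: "x$2$2 = - x$1$1"
    using x by (simp add: trace_def sum_2 eq_neg_iff_add_eq_0 add.commute)
  have "(1 - 2 * p) * (2 * p - 1) - 4 * (q * r) = - 1"
    using x by (simp add: det_2 x22 xe)
  then have "4 * (p * (1 - p)) = 4 * (q * r)"
    by (simp add: algebra_simps)
  then have pqr: "p * (1 - p) = q * r" by simp
  have *: "is_reflection (*s) UNIV ((*v) x)"
    if "a$1 * l1 = p" "a$1 * l2 = q" "a$2 * l1 = r" "a$2 * l2 = 1 - p" for a :: "complex^2" and l1 l2
    unfolding is_reflection_def
  proof (intro exI[of _ "\<lambda>v. l1 * v$1 + l2 * v$2"] exI[of _ a] conjI ballI)
    show "linear_on_set (*s) (*) UNIV (\<lambda>v. l1 * v$1 + l2 * v$2)"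
      by (simp add: linear_on_set_def algebra_simps)
    show "l1 * a$1 + l2 * a$2 = 1"
      using that(1,4) by (simp add: mult.commute)
    have e: "x$1$1 = 1 - 2 * (a$1 * l1)" "x$1$2 = - 2 * (a$1 * l2)" "x$2$1 = - 2 * (a$2 * l1)"
        "x$2$2 = 1 - 2 * (a$2 * l2)"
      by (simp_all add: that xe x22)
    show "x *v v = v - (2 * (l1 * v$1 + l2 * v$2)) *s a" for v
      by (simp only: vec_eq_iff forall_2 matrix_vector_mult_def sum_2 vec_lambda_beta e)
        (simp add: algebra_simps)
  qed simp
  show "is_reflection (*s) (UNIV :: (complex^2) set) ((*v) x)"
  \<comment> \<open>The factorization divides by a nonzero diagonal entry: \<open>p\<close> itself,
    or \<open>1 - p = 1\<close> when \<open>p = 0\<close>.\<close>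
  proof (cases "p = 0")
    case True
    then have "q * r = 0" using pqr by simp
    then show ?thesis using True by (intro *[of "vector [q, 1]" r 1]) auto
  next
    case False
    then have "r * (q / p) = 1 - p" using pqr by (simp add: field_simps)
    then show ?thesis using False by (intro *[of "vector [p, r]" 1 "q / p"]) auto
  qed
qed

lemma is_reflection_rho_tilde:
  assumes w: "w \<in> su2" "w \<noteq> 0" and x: "x = reflection_elt w \<or> x = - reflection_elt w"
  shows "is_reflection scaleR su2 (rho_tilde x)"
proof -
  have "rho_tilde x = rho_tilde (reflection_elt w)"
    using x reflection_elt(1)[OF w] rho_tilde_eq_iff[of x "reflection_elt w"] uminus_U2pm by auto
  moreover have "is_reflection scaleR su2 (rho_tilde (reflection_elt w))"
    unfolding is_reflection_def
  proof (intro exI[of _ "\<lambda>B. (w \<bullet> B) / (w \<bullet> w)"] exI[of _ w] conjI ballI)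
    show "linear_on_set scaleR (*) su2 (\<lambda>B. (w \<bullet> B) / (w \<bullet> w))"
      by (simp add: linear_on_set_def inner_add_right add_divide_distrib)
  qed (use w rho_tilde_reflection_elt[OF w] in auto)
  ultimately show ?thesis by simp
qed

text \<open>An isometry \<open>v \<mapsto> v - 2 l(v) a\<close> sends \<open>a\<close> to \<open>- a\<close>, which forces \<open>l(v) = \<langle>v, a\<rangle> / \<langle>a, a\<rangle>\<close>.\<close>

lemma reflection_rho_tildeD:
  assumes x: "x \<in> carrier U2pm" and refl: "is_reflection scaleR su2 (rho_tilde x)"
  obtains w where "w \<in> su2" "w \<noteq> 0" "x = reflection_elt w \<or> x = - reflection_elt w"
proof -
  obtain l a where l: "linear_on_set scaleR (*) su2 l" and a: "a \<in> su2" "l a = 1"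
      and s: "\<And>v. v \<in> su2 \<Longrightarrow> rho_tilde x v = v - (2 * l v) *\<^sub>R a"
    using refl by (auto simp: is_reflection_def)
  have "l (0 *\<^sub>R a) = 0 * l a" using l a(1) unfolding linear_on_set_def by blast
  then have "a \<noteq> 0" using a(2) by auto
  have "l v = (a \<bullet> v) / (a \<bullet> a)" if v: "v \<in> su2" for v
  proof -
    have "(v - (2 * l v) *\<^sub>R a) \<bullet> (a - (2 * l a) *\<^sub>R a) = v \<bullet> a"
      using O3_inner[OF rho_tilde_O3[OF x] v a(1)] by (simp only: s[OF v] s[OF a(1)])
    then have "l v * (a \<bullet> a) = a \<bullet> v"
      by (simp add: a(2) scaleR_2 inner_diff_left inner_diff_right inner_commute)
    then show ?thesis using \<open>a \<noteq> 0\<close> by (simp add: field_simps)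
  qed
  then have "rho_tilde x = rho_tilde (reflection_elt a)"
    by (intro extensionalityI[OF rho_tilde_extensional rho_tilde_extensional])
       (simp add: s rho_tilde_reflection_elt[OF a(1) \<open>a \<noteq> 0\<close>])
  then show ?thesis
    using rho_tilde_eq_iff[OF x reflection_elt(1)[OF a(1) \<open>a \<noteq> 0\<close>]] that[OF a(1) \<open>a \<noteq> 0\<close>] by simp
qed

text \<open>Determinant \<open>- 1\<close> and trace zero make \<open>x\<close> hermitian, so
  \<open>\<i> *\<^sub>C x\<close> is skew-hermitian. Its norm is \<open>sqrt 2\<close>, so
  \<open>reflection_elt\<close> merely multiplies by \<open>\<i>\<close> once more, which explains
  the minus sign.\<close>

lemma traceless_reflection_elt:
  assumes "x \<in> carrier U2pm" "trace x = 0" "det x = - 1"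
  shows "\<i> *\<^sub>C x \<in> su2" "\<i> *\<^sub>C x \<noteq> 0" "x = - reflection_elt (\<i> *\<^sub>C x)"
proof -
  obtain a b d where x: "x = mat2 a b (- d * cnj b) (d * cnj a)"
      "a * cnj a + b * cnj b = 1" "d = 1 \<or> d = - 1" "det x = d"
    by (rule U2pmE[OF assms(1)])
  have d: "d = - 1" using x(4) assms(3) by simp
  have "a = cnj a" using assms(2) by (simp add: x(1) d trace_def sum_2)
  then have "Im a = 0" by (simp add: complex_eq_iff)
  then show su2: "\<i> *\<^sub>C x \<in> su2" by (simp add: x(1) d su2_iff)
  have "complex_of_real (((\<i> *\<^sub>C x) \<bullet> (\<i> *\<^sub>C x)) / 2) = 1"
    unfolding det_su2[OF su2, symmetric] by (simp add: det_cscale assms(3))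
  then have "(\<i> *\<^sub>C x) \<bullet> (\<i> *\<^sub>C x) = 2"
    unfolding of_real_eq_1_iff by simp
  then have n: "norm (\<i> *\<^sub>C x) = sqrt 2" by (simp add: norm_eq_sqrt_inner)
  then show "\<i> *\<^sub>C x \<noteq> 0" by auto
  show "x = - reflection_elt (\<i> *\<^sub>C x)"
    unfolding reflection_elt_def n by (simp add: cmat2_eq_iff)
qed

lemma is_reflection_iff:
  assumes x: "x \<in> carrier U2pm"
  shows "is_reflection (*s) (UNIV :: (complex^2) set) ((*v) x) \<longleftrightarrow>
    is_reflection scaleR su2 (rho_tilde x)"
  unfolding is_reflection_cmat2_iff
proof
  assume "trace x = 0 \<and> det x = - 1"
  then show "is_reflection scaleR su2 (rho_tilde x)"
    using traceless_reflection_elt[OF x] is_reflection_rho_tilde[of "\<i> *\<^sub>C x" x] by simp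
next
  assume "is_reflection scaleR su2 (rho_tilde x)"
  then obtain w where w: "w \<in> su2" "w \<noteq> 0" "x = reflection_elt w \<or> x = - reflection_elt w"
    by (rule reflection_rho_tildeD[OF x])
  \<comment> \<open>The sign left open by the fibres of \<open>rho_tilde\<close> affects neither
    trace zero nor the determinant.\<close>
  have "trace (- A) = - trace A" "det (- A) = det A" for A :: cmat2
    by (simp_all add: trace_def sum_2 det_2)
  then show "trace x = 0 \<and> det x = - 1"
    using w(3) reflection_elt(2,3)[OF w(1,2)] by auto
qed

lemma rho_apply: "A \<in> carrier SU2 \<Longrightarrow> rho A = rho_tilde A"
  by (simp add: rho_def)

theorem theorem3p10:
  shows
    "short_exact SU2 U2pm sign_group id det \<and>
     short_exact SO3 O3 sign_group id (\<lambda>f. complex_of_real (su2_det f)) \<and>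
     short_exact pm_id_group SU2 SO3 id rho \<and>
     short_exact pm_id_group U2pm O3 id rho_tilde \<and>
     (\<forall>A\<in>carrier SU2. (rho_tilde \<circ> id) A = (id \<circ> rho) A) \<and>
     (\<forall>A\<in>carrier U2pm. complex_of_real (su2_det (rho_tilde A)) = det A) \<and>
     id ` kernel SU2 SO3 rho = kernel U2pm O3 rho_tilde \<and>
     (\<forall>A\<in>kernel SU2 SO3 rho. id A = A) \<and>
     universal_group_covering SU2 rho SO3 \<and>
     identifies_coverings id E3_to_su2 PIN3 pin_covering O_E3 U2pm rho_tilde O3 \<and>
     (\<forall>x\<in>carrier U2pm.
        is_reflection (*s) (UNIV :: (complex^2) set) ((*v) x) \<longleftrightarrow>
        is_reflection scaleR su2 (rho_tilde x))"
  using short_exact_det short_exact_su2_det short_exact_rho short_exact_rho_tilde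
    su2_det_rho_tilde group_covering_rho simply_connected_SU2 identifies_pin_covering is_reflection_iff
  by (simp add: universal_group_covering_def kernel_rho kernel_rho_tilde rho_apply)

end
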